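(* Let $\theta\colon\mathcal{A}\to\mathcal{A}^R$ be an injective, primitive and aperiodic block substitution in $\mathbb{Z}^d$ with expansive matrix $Q=\mathrm{diag}(\ell_1,\dots,\ell_d)$ and trivial height lattice, and let $\mathcal{Z}_\theta=\bigcup_{J}X_J\subseteq R^{\mathbb{N}}$, the union over proper subsets $J\subsetneq\{1,\dots,d\}$, be the sofic shift built from the reversed and pruned graphs $\widetilde{\mathcal{G}}(\theta,J)^{\mathrm{op}}$. Then any $\boldsymbol z\in\mathbb{Z}^d_Q\setminus\mathbb{Z}^d$ constitutes an irregular fibre (that is, $|\pi_{\rm MEF}^{-1}(\boldsymbol z)|>c_\theta$) if, and only if, $\boldsymbol z+\boldsymbol N\in\mathcal{Z}_\theta$ for some $\boldsymbol N\in\mathbb{Z}^d$.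
   Context: Block substitutions: $\mathcal{A}$ is a finite alphabet, $\ell_j\ge2$ integers, $R=\prod_{j=1}^d\{0,\dots,\ell_j-1\}$, $\theta\colon\mathcal{A}\to\mathcal{A}^R$, with columns $\theta_{\boldsymbol j}(a)=\theta(a)_{\boldsymbol j}$. The power $\theta^n$ has support $\prod_j\{0,\dots,\ell_j^n-1\}$ and columns $\theta^n_{\boldsymbol j}=\theta_{\boldsymbol j_0}\circ\cdots\circ\theta_{\boldsymbol j_{n-1}}$ for $\boldsymbol j=\sum_{i<n}Q^i\boldsymbol j_i$, $\boldsymbol j_i\in R$; on configurations and patterns $\theta(x)_{Q\boldsymbol m+\boldsymbol j}=\theta_{\boldsymbol j}(x_{\boldsymbol m})$. $\mathbb{X}_\theta\subseteq\mathcal{A}^{\mathbb{Z}^d}$ is the subshift whose language consists of the finite patterns occurring (up to translation) in some $\theta^k(a)$; patterns in this language are called legal, and $\mathcal{L}_B(\mathbb{X}_\theta)$ is the set of legal patterns with support $B$. Injective: $a\mapsto\theta(a)$ is injective. Primitive: for some $k$ every $\theta^k(a)$ contains all letters. Aperiodic: no element of $\mathbb{X}_\theta$ has a non-zero period. Column number: $c_\theta=\min_{k\ge1}\min_{\boldsymbol j\in\mathrm{supp}(\theta^k)}|\theta^k_{\boldsymbol j}(\mathcal{A})|$. Height lattice: the smallest sublattice $\Gamma\le\mathbb{Z}^d$ that contains all $\boldsymbol j$ such that $x_{\boldsymbol j+\boldsymbol k}=x_{\boldsymbol k}$ for some $\boldsymbol k$ (with $x\in\mathbb{X}_\theta$ fixed,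 arbitrary) and satisfies $\Gamma+Q^k\mathbb{Z}^d=\mathbb{Z}^d$ for all $k\ge1$; it is trivial if $\Gamma=\mathbb{Z}^d$. Odometer and factor map: $\mathbb{Z}_Q^d=\varprojlim\mathbb{Z}^d/Q^k\mathbb{Z}^d$, whose elements are identified with digit sequences $(\boldsymbol n_k)_{k\ge0}\in R^{\mathbb{N}}$ via $\boldsymbol z=\sum_kQ^k\boldsymbol n_k$. With $\sigma_{\boldsymbol n}(x)_{\boldsymbol i}=x_{\boldsymbol i+\boldsymbol n}$, for each $x\in\mathbb{X}_\theta$ and $k$ there are unique $y\in\mathbb{X}_\theta$ and $\boldsymbol j_k\in\mathrm{supp}(\theta^k)$ with $x=\sigma_{\boldsymbol j_k}\theta^k(y)$, and $\pi_{\rm tile}(x)\in\mathbb{Z}_Q^d$ is the element congruent to $\boldsymbol j_k$ mod $Q^k\mathbb{Z}^d$ for all $k$. For trivial height lattice $\pi_{\rm MEF}=\pi_{\rm tile}$. Derived substitutions and graphs: for $J\subsetneq\{1,\dots,d\}$ let $B_J=\prod_{j\in J}\{-1,0\}\times\prod_{j\notin J}\{0\}$, $\mathcal{A}_J=\mathcal{L}_{B_J}(\mathbb{X}_\theta)$ and $R_J=\prod_{j\notin J}\{0,\dots,\ell_j-1\}$. The $J$-derived substitution $\partial_J\theta\colon\mathcal{A}_J\to\mathcal{A}_J^{R_J}$ (a substitution of dimension $d-|J|$) has, for $\widehat{\boldsymbol n}\in R_J$, the column $(\partial_J\theta)_{\widehat{\boldsymbol n}}(P)=\theta(P)|_{B_J+\boldsymbol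 n}$ (translated to $B_J$), where $\boldsymbol n\in R$ is $\widehat{\boldsymbol n}$ extended by $0$ in the coordinates of $J$; so for $J=\{k\}$ the two-letter pattern $ab$ (in direction $k$) is sent to the pairs formed by the last slice of $\theta(a)$ and the first slice of $\theta(b)$ in direction $k$. For $J=\varnothing$, $\partial_J\theta=\theta$. The graph $\mathcal{G}(\theta,J)$ is the smallest directed labelled graph whose vertices are subsets of $\mathcal{A}_J$, having $\mathcal{A}_J$ as a vertex, and with, for each vertex $U$ and each $\widehat{\boldsymbol n}\in R_J$, an edge labelled $\widehat{\boldsymbol n}$ from $U$ to $(\partial_J\theta)_{\widehat{\boldsymbol n}}(U)$. $\mathcal{G}(\theta,J)^{\mathrm{op}}$ is obtained by reversing all edges, and $\widetilde{\mathcal{G}}(\theta,J)^{\mathrm{op}}$ by then removing all vertices of cardinality $c_\theta$. $X_J$ is the set of label sequences $(\widehat{\boldsymbol n}_0,\widehat{\boldsymbol n}_1,\dots)$ of infinite paths $e_0e_1e_2\dots$ in $\widetilde{\mathcal{G}}(\theta,J)^{\mathrm{op}}$, regarded as a subset of $R^{\mathbb{N}}$ by inserting the digit $0$ in all coordinates belonging to $J$; a sequence $(\boldsymbol n_k)_{k\ge0}\in R^{\mathbb{N}}$ is identified with the point $\sum_{k\ge0}Q^k\boldsymbol n_k$ of $\mathbb{Z}_Q^d$ ($\widehat{\boldsymbol n}_0$ being the lowest digit). *)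

theory Defs
  imports "HOL-Analysis.Finite_Cartesian_Product" "HOL-Library.FuncSet"
begin

text \<open>
  The dimension is the cardinality of the finite index type \<open>'d\<close>, so that \<open>int ^ 'd\<close> is the
  group $Z^d$ and coordinate sets $J$ have type \<open>'d set\<close>. The alphabet is the finite type \<open>'a\<close>.
  The vector \<open>l\<close> holds the side lengths, that is \<open>Q = diag(l)\<close>. A substitution is given as
  \<open>\<theta> :: 'a \<Rightarrow> int ^ 'd \<Rightarrow> 'a\<close>, where \<open>\<theta> a j\<close> is the letter of \<open>\<theta>(a)\<close> at position \<open>j \<in> R\<close>;
  its values at positions outside \<open>R = supp l 1\<close> are never used.
\<close>

section \<open>Block substitutions\<close>

text \<open>Multiplication by \<open>Q ^ k\<close>, and coordinatewise quotient and remainder modulo \<open>Q ^ k\<close>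
  (rounding towards minus infinity, so remainders lie in \<open>supp l k\<close>).\<close>

definition qmul :: "int ^ 'd \<Rightarrow> nat \<Rightarrow> int ^ 'd \<Rightarrow> int ^ 'd" where
  "qmul l k m = (\<chi> i. l $ i ^ k * m $ i)"

definition qdiv :: "int ^ 'd \<Rightarrow> nat \<Rightarrow> int ^ 'd \<Rightarrow> int ^ 'd" where
  "qdiv l k m = (\<chi> i. m $ i div l $ i ^ k)"

definition qmod :: "int ^ 'd \<Rightarrow> nat \<Rightarrow> int ^ 'd \<Rightarrow> int ^ 'd" where
  "qmod l k m = (\<chi> i. m $ i mod l $ i ^ k)"

definition supp :: "int ^ 'd \<Rightarrow> nat \<Rightarrow> (int ^ 'd) set" where
  "supp l k = {j. \<forall>i. 0 \<le> j $ i \<and> j $ i < l $ i ^ k}"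

text \<open>The lowest digit of \<open>j\<close> belongs to the outermost column:
  $\theta^{n+1}_j = \theta_{j_0} \circ \theta^n_{j'}$ for $j = j_0 + Q j'$.\<close>

primrec subst_pow ::
  "int ^ 'd \<Rightarrow> ('a \<Rightarrow> int ^ 'd \<Rightarrow> 'a) \<Rightarrow> nat \<Rightarrow> 'a \<Rightarrow> int ^ 'd \<Rightarrow> 'a" where
  "subst_pow l \<theta> 0 a j = a"
| "subst_pow l \<theta> (Suc n) a j = \<theta> (subst_pow l \<theta> n a (qdiv l 1 j)) (qmod l 1 j)"

definition subst_conf ::
  "int ^ 'd \<Rightarrow> ('a \<Rightarrow> int ^ 'd \<Rightarrow> 'a) \<Rightarrow> (int ^ 'd \<Rightarrow> 'a) \<Rightarrow> (int ^ 'd \<Rightarrow> 'a)" where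
  "subst_conf l \<theta> x = (\<lambda>i. \<theta> (x (qdiv l 1 i)) (qmod l 1 i))"

text \<open>Patterns are partial maps whose domain is their support.\<close>

definition subst_pat ::
  "int ^ 'd \<Rightarrow> ('a \<Rightarrow> int ^ 'd \<Rightarrow> 'a) \<Rightarrow> (int ^ 'd \<rightharpoonup> 'a) \<Rightarrow> (int ^ 'd \<rightharpoonup> 'a)" where
  "subst_pat l \<theta> P = (\<lambda>i. map_option (\<lambda>a. \<theta> a (qmod l 1 i)) (P (qdiv l 1 i)))"

definition shift :: "int ^ 'd \<Rightarrow> (int ^ 'd \<Rightarrow> 'a) \<Rightarrow> (int ^ 'd \<Rightarrow> 'a)" where
  "shift n x = (\<lambda>i. x (i + n))"

definition legal ::
  "int ^ 'd \<Rightarrow> ('a \<Rightarrow> int ^ 'd \<Rightarrow> 'a) \<Rightarrow> (int ^ 'd \<rightharpoonup> 'a) \<Rightarrow> bool" where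
  "legal l \<theta> P \<longleftrightarrow> finite (dom P) \<and>
     (\<exists>k a t. \<forall>i\<in>dom P. i + t \<in> supp l k \<and> P i = Some (subst_pow l \<theta> k a (i + t)))"

definition lang ::
  "int ^ 'd \<Rightarrow> ('a \<Rightarrow> int ^ 'd \<Rightarrow> 'a) \<Rightarrow> (int ^ 'd) set \<Rightarrow> (int ^ 'd \<rightharpoonup> 'a) set" where
  "lang l \<theta> B = {P. dom P = B \<and> legal l \<theta> P}"

definition subshift ::
  "int ^ 'd \<Rightarrow> ('a \<Rightarrow> int ^ 'd \<Rightarrow> 'a) \<Rightarrow> (int ^ 'd \<Rightarrow> 'a) set" where
  "subshift l \<theta> = {x. \<forall>B. finite B \<longrightarrow> legal l \<theta> ((Some \<circ> x) |` B)}"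

definition injective_subst :: "int ^ 'd \<Rightarrow> ('a \<Rightarrow> int ^ 'd \<Rightarrow> 'a) \<Rightarrow> bool" where
  "injective_subst l \<theta> \<longleftrightarrow> inj (\<lambda>a. restrict (\<theta> a) (supp l 1))"

definition primitive_subst :: "int ^ 'd \<Rightarrow> ('a \<Rightarrow> int ^ 'd \<Rightarrow> 'a) \<Rightarrow> bool" where
  "primitive_subst l \<theta> \<longleftrightarrow> (\<exists>k\<ge>1. \<forall>a. subst_pow l \<theta> k a ` supp l k = UNIV)"

definition aperiodic_subst :: "int ^ 'd \<Rightarrow> ('a \<Rightarrow> int ^ 'd \<Rightarrow> 'a) \<Rightarrow> bool" where
  "aperiodic_subst l \<theta> \<longleftrightarrow> (\<forall>x\<in>subshift l \<theta>. \<forall>p. shift p x = x \<longrightarrow> p = 0)"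

definition column_number :: "int ^ 'd \<Rightarrow> ('a \<Rightarrow> int ^ 'd \<Rightarrow> 'a) \<Rightarrow> nat" where
  "column_number l \<theta> =
     (LEAST c. \<exists>k\<ge>1. \<exists>j\<in>supp l k. c = card (range (\<lambda>a. subst_pow l \<theta> k a j)))"

section \<open>Height lattice\<close>

text \<open>Sublattices are written as subgroups of \<open>int ^ 'd\<close>. A subgroup containing all these
  return vectors automatically has full rank, since the alphabet is finite.\<close>

definition height_admissible ::
  "int ^ 'd \<Rightarrow> (int ^ 'd \<Rightarrow> 'a) \<Rightarrow> (int ^ 'd) set \<Rightarrow> bool" where
  "height_admissible l x \<Gamma> \<longleftrightarrow>
     0 \<in> \<Gamma> \<and> (\<forall>u\<in>\<Gamma>. \<forall>v\<in>\<Gamma>. u + v \<in> \<Gamma>) \<and> (\<forall>u\<in>\<Gamma>. - u \<in> \<Gamma>) \<and>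
     (\<forall>j. (\<exists>k. x (j + k) = x k) \<longrightarrow> j \<in> \<Gamma>) \<and>
     (\<forall>k\<ge>1. {g + qmul l k m | g m. g \<in> \<Gamma>} = UNIV)"

definition is_height_lattice ::
  "int ^ 'd \<Rightarrow> (int ^ 'd \<Rightarrow> 'a) \<Rightarrow> (int ^ 'd) set \<Rightarrow> bool" where
  "is_height_lattice l x \<Gamma> \<longleftrightarrow>
     height_admissible l x \<Gamma> \<and> (\<forall>\<Gamma>'. height_admissible l x \<Gamma>' \<longrightarrow> \<Gamma> \<subseteq> \<Gamma>')"

text \<open>For primitive \<open>\<theta>\<close> all elements of the subshift have the same patterns, so the choice
  of \<open>x\<close> does not matter.\<close>

definition trivial_height :: "int ^ 'd \<Rightarrow> ('a \<Rightarrow> int ^ 'd \<Rightarrow> 'a) \<Rightarrow> bool" where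
  "trivial_height l \<theta> \<longleftrightarrow> (\<exists>x\<in>subshift l \<theta>. is_height_lattice l x UNIV)"

section \<open>Odometer and factor map\<close>

text \<open>An element of the inverse limit of the groups $Z^d / Q^k Z^d$ is represented by the
  coherent sequence of its canonical representatives in \<open>supp l k\<close>.\<close>

definition odometer :: "int ^ 'd \<Rightarrow> (nat \<Rightarrow> int ^ 'd) set" where
  "odometer l = {z. \<forall>k. z k \<in> supp l k \<and> qmod l k (z (Suc k)) = z k}"

definition odo_of_int :: "int ^ 'd \<Rightarrow> int ^ 'd \<Rightarrow> (nat \<Rightarrow> int ^ 'd)" where
  "odo_of_int l m = (\<lambda>k. qmod l k m)"

definition odo_add ::
  "int ^ 'd \<Rightarrow> (nat \<Rightarrow> int ^ 'd) \<Rightarrow> (nat \<Rightarrow> int ^ 'd) \<Rightarrow> (nat \<Rightarrow> int ^ 'd)" where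
  "odo_add l z w = (\<lambda>k. qmod l k (z k + w k))"

text \<open>The point $\sum_k Q^k n_k$ given by a digit sequence with values in \<open>R\<close>; the partial sum
  of the first \<open>k\<close> terms already lies in \<open>supp l k\<close>.\<close>

definition odo_of_digits :: "int ^ 'd \<Rightarrow> (nat \<Rightarrow> int ^ 'd) \<Rightarrow> (nat \<Rightarrow> int ^ 'd)" where
  "odo_of_digits l n = (\<lambda>k. \<Sum>i<k. qmul l i (n i))"

text \<open>By recognisability, the \<open>j\<close> below exists and is unique whenever \<open>x\<close> is in the subshift of
  an injective, primitive and aperiodic substitution. If the height lattice is trivial, this map
  is the factor map onto the maximal equicontinuous factor.\<close>

definition pi_tile ::
  "int ^ 'd \<Rightarrow> ('a \<Rightarrow> int ^ 'd \<Rightarrow> 'a) \<Rightarrow> (int ^ 'd \<Rightarrow> 'a) \<Rightarrow> (nat \<Rightarrow> int ^ 'd)" where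
  "pi_tile l \<theta> x =
     (\<lambda>k. THE j. j \<in> supp l k \<and>
        (\<exists>y\<in>subshift l \<theta>. x = shift j ((subst_conf l \<theta> ^^ k) y)))"

definition fibre ::
  "int ^ 'd \<Rightarrow> ('a \<Rightarrow> int ^ 'd \<Rightarrow> 'a) \<Rightarrow> (nat \<Rightarrow> int ^ 'd) \<Rightarrow> (int ^ 'd \<Rightarrow> 'a) set" where
  "fibre l \<theta> z = {x\<in>subshift l \<theta>. pi_tile l \<theta> x = z}"

text \<open>The first disjunct is needed because \<open>card\<close> is \<open>0\<close> on infinite sets.\<close>

definition irregular_fibre ::
  "int ^ 'd \<Rightarrow> ('a \<Rightarrow> int ^ 'd \<Rightarrow> 'a) \<Rightarrow> (nat \<Rightarrow> int ^ 'd) \<Rightarrow> bool" where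
  "irregular_fibre l \<theta> z \<longleftrightarrow>
     infinite (fibre l \<theta> z) \<or> card (fibre l \<theta> z) > column_number l \<theta>"

section \<open>Derived substitutions and their graphs\<close>

definition corner :: "'d set \<Rightarrow> (int ^ 'd) set" where
  "corner J = {b. \<forall>i. b $ i \<in> (if i \<in> J then {-1, 0} else {0})}"

definition alphabet_at ::
  "int ^ 'd \<Rightarrow> ('a \<Rightarrow> int ^ 'd \<Rightarrow> 'a) \<Rightarrow> 'd set \<Rightarrow> (int ^ 'd \<rightharpoonup> 'a) set" where
  "alphabet_at l \<theta> J = lang l \<theta> (corner J)"

text \<open>The elements of $R_J$ are stored with the digit \<open>0\<close> inserted in the coordinates of \<open>J\<close>;
  label sequences below are thereby sequences with values in \<open>R\<close>.\<close>

definition labels_at :: "int ^ 'd \<Rightarrow> 'd set \<Rightarrow> (int ^ 'd) set" where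
  "labels_at l J = {n \<in> supp l 1. \<forall>i\<in>J. n $ i = 0}"

definition derived_column ::
  "int ^ 'd \<Rightarrow> ('a \<Rightarrow> int ^ 'd \<Rightarrow> 'a) \<Rightarrow> 'd set \<Rightarrow> int ^ 'd \<Rightarrow>
    (int ^ 'd \<rightharpoonup> 'a) \<Rightarrow> (int ^ 'd \<rightharpoonup> 'a)" where
  "derived_column l \<theta> J n P = (\<lambda>b. subst_pat l \<theta> P (b + n)) |` corner J"

inductive_set graph_verts ::
  "int ^ 'd \<Rightarrow> ('a \<Rightarrow> int ^ 'd \<Rightarrow> 'a) \<Rightarrow> 'd set \<Rightarrow> (int ^ 'd \<rightharpoonup> 'a) set set"
  for l \<theta> J where
  start: "alphabet_at l \<theta> J \<in> graph_verts l \<theta> J"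
| step: "U \<in> graph_verts l \<theta> J \<Longrightarrow> n \<in> labels_at l J \<Longrightarrow>
    derived_column l \<theta> J n ` U \<in> graph_verts l \<theta> J"

text \<open>Edges are triples (source, label, target).\<close>

definition graph_edges ::
  "int ^ 'd \<Rightarrow> ('a \<Rightarrow> int ^ 'd \<Rightarrow> 'a) \<Rightarrow> 'd set \<Rightarrow>
    ((int ^ 'd \<rightharpoonup> 'a) set \<times> (int ^ 'd) \<times> (int ^ 'd \<rightharpoonup> 'a) set) set" where
  "graph_edges l \<theta> J =
     {(U, n, derived_column l \<theta> J n ` U) | U n. U \<in> graph_verts l \<theta> J \<and> n \<in> labels_at l J}"

definition op_edges ::
  "int ^ 'd \<Rightarrow> ('a \<Rightarrow> int ^ 'd \<Rightarrow> 'a) \<Rightarrow> 'd set \<Rightarrow>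
    ((int ^ 'd \<rightharpoonup> 'a) set \<times> (int ^ 'd) \<times> (int ^ 'd \<rightharpoonup> 'a) set) set" where
  "op_edges l \<theta> J = {(V, n, U). (U, n, V) \<in> graph_edges l \<theta> J}"

definition pruned_op_edges ::
  "int ^ 'd \<Rightarrow> ('a \<Rightarrow> int ^ 'd \<Rightarrow> 'a) \<Rightarrow> 'd set \<Rightarrow>
    ((int ^ 'd \<rightharpoonup> 'a) set \<times> (int ^ 'd) \<times> (int ^ 'd \<rightharpoonup> 'a) set) set" where
  "pruned_op_edges l \<theta> J =
     {(V, n, U) \<in> op_edges l \<theta> J. card V \<noteq> column_number l \<theta> \<and> card U \<noteq> column_number l \<theta>}"

definition label_shift ::
  "int ^ 'd \<Rightarrow> ('a \<Rightarrow> int ^ 'd \<Rightarrow> 'a) \<Rightarrow> 'd set \<Rightarrow> (nat \<Rightarrow> int ^ 'd) set" where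
  "label_shift l \<theta> J =
     {n. \<exists>V. \<forall>k. (V k, n k, V (Suc k)) \<in> pruned_op_edges l \<theta> J}"

definition sofic_shift ::
  "int ^ 'd \<Rightarrow> ('a \<Rightarrow> int ^ 'd \<Rightarrow> 'a) \<Rightarrow> (nat \<Rightarrow> int ^ 'd) set" where
  "sofic_shift l \<theta> = (\<Union>J\<in>{J. J \<subset> UNIV}. label_shift l \<theta> J)"

end

theory Submission
  imports Defs
begin

text \<open>
  Two facts make the theorem work: supertiles can be recognised, and a point of a fibre is
  determined by what it shows at the places where its supertiles meet.

  Recognisability. A supertile of level \<open>n\<close> is a translate of some \<open>\<theta>\<^sup>n(a)\<close>. An offset of level \<open>n\<close>
  is a vector \<open>u\<close> with \<open>\<theta>\<^sup>n(y) = \<sigma>\<^sub>u(\<theta>\<^sup>n(y'))\<close> for some \<open>y, y'\<close> in the subshift; the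
  claim is that offsets of level \<open>n\<close> lie in \<open>Q\<^sup>n\<int>\<^sup>d\<close> (\<open>offset_trivial\<close>). If some level had very many offsets modulo \<open>Q\<^sup>n\<close>, two of
  them would be close together and shift supertiles of the same letter over each other, so that
  supertile would be invariant under a translation that is short compared with its size. Since large
  supertiles show all legal patches of bounded size in terms of smaller supertiles, this translation
  would be a global period (\<open>short_translation_trivial\<close>). So the number of offsets modulo \<open>Q\<^sup>n\<close> is bounded;
  as multiplication by \<open>Q\<close> maps those of level \<open>n\<close> injectively to those of level \<open>n + 1\<close>,
  eventually all offsets arise in this way, and those of level \<open>N + t\<close> are divisible by \<open>Q\<^sup>t\<close>
  (\<open>offsets_divisible\<close>). Conversely an offset of level \<open>n\<close> becomes one of level \<open>n + N\<close> after
  adding an element of \<open>Q\<^sup>n\<int>\<^sup>d\<close> (\<open>offsets_refine\<close>), whence it is divisible by \<open>Q\<^sup>n\<close> itself.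

  Fibres. Let \<open>J\<close> be the set of integral coordinates of \<open>z\<close>, moved to \<open>0\<close> by a translation. In
  these directions the boundary between two supertiles stays next to the origin, and in the others
  the supertiles exhaust both sides. Thus a point \<open>x\<close> of the fibre is described by the patterns
  on \<open>corner J\<close> of its desubstitutions of all levels, and the pattern of level \<open>k\<close> is the image of
  the one of level \<open>k + 1\<close> under the column of the derived substitution given by the \<open>k\<close>-th
  digit. Conversely, by compactness, a pattern that has preimages at all levels is the
  corner of a point of the fibre (\<open>corner_lifts_to_fibre\<close>).

  A path in the reversed graph is a sequence of sets of patterns, each being the image of the next,
  all of more than \<open>c\<close> elements, where \<open>c\<close> is the column number, since vertices never have fewer
  (\<open>card_graph_vert\<close>). Its first vertex lifts injectively to the fibre
  (\<open>label_shift_irregular\<close>). In the other direction, more than \<open>c\<close> points of a fibre are distinguished by their corners from some level on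
  (\<open>fibre_points_separate\<close>), and so the sets of patterns that descend from arbitrarily high levels
  form a path whose vertices are large from that level on. The first vertices may still be small.
  But the graph is finite, so the path meets some large vertex twice, and its beginning can be
  replaced by a walk around the resulting cycle (\<open>replace_beginning\<close>). This changes finitely
  many digits, that is, it adds an element of \<open>\<int>\<^sup>d\<close> to \<open>z\<close>.
\<close>

section \<open>Compactness\<close>

text \<open>The full shift is compact: choose nested infinite sets of indices along an enumeration of the
  positions.\<close>

lemma cluster_point:
  fixes f :: "nat \<Rightarrow> int ^ 'd::finite \<Rightarrow> 'a::finite"
  obtains x where "\<And>(B :: (int ^ 'd) set) N. finite B \<Longrightarrow> \<exists>n\<ge>N. \<forall>t\<in>B. f n t = x t"
proof -
  have "\<exists>I. \<forall>k. infinite (I k) \<and> (I (Suc k) \<subseteq> I k \<and>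
      (\<exists>a. \<forall>n\<in>I (Suc k). f n (from_nat k) = a))"
  proof (rule dependent_nat_choice)
    show "\<exists>I :: nat set. infinite I"
      by (rule exI[of _ UNIV]) simp
  next
    fix I :: "nat set" and k
    assume "infinite I"
    then have "\<exists>a\<in>UNIV. infinite {n \<in> I. f n (from_nat k) = a}"
      by (intro pigeonhole_infinite_rel) auto
    then show "\<exists>I'. infinite I' \<and> (I' \<subseteq> I \<and> (\<exists>a. \<forall>n\<in>I'. f n (from_nat k) = a))"
      by (metis (mono_tags, lifting) mem_Collect_eq subsetI)
  qed
  then obtain I where I: "\<And>k. infinite (I k)" "\<And>k. I (Suc k) \<subseteq> I k"
      "\<And>k. \<exists>a. \<forall>n\<in>I (Suc k). f n (from_nat k) = a"
    by blast
  from I(3) obtain a where a: "\<And>k n. n \<in> I (Suc k) \<Longrightarrow> f n (from_nat k) = a k"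
    by metis
  define x where "x = (\<lambda>t :: int ^ 'd. a (to_nat t))"
  have anti: "I k \<subseteq> I j" if "j \<le> k" for j k
    using that I(2) by (rule lift_Suc_antimono_le[rotated])
  have "\<exists>n\<ge>N. \<forall>t\<in>B. f n t = x t" if B: "finite B" for B :: "(int ^ 'd) set" and N
  proof -
    obtain K where K: "\<And>t. t \<in> B \<Longrightarrow> to_nat t < K"
      using finite_nat_set_iff_bounded[of "to_nat ` B"] B by blast
    obtain n where n: "n \<ge> N" "n \<in> I K"
      using I(1)[of K] by (meson infinite_nat_iff_unbounded_le)
    have "f n t = x t" if "t \<in> B" for t
    proof -
      have "n \<in> I (Suc (to_nat t))"
        using anti[of "Suc (to_nat t)" K] K[OF that] n(2) by (auto simp: Suc_le_eq)
      from a[OF this] show ?thesis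
        by (simp add: x_def)
    qed
    then show ?thesis
      using n(1) by blast
  qed
  then show ?thesis
    using that by blast
qed

text \<open>Closedness in the product topology, with the alphabet discrete.\<close>

definition limit_closed :: "(int ^ 'd::finite \<Rightarrow> 'a::finite) set \<Rightarrow> bool" where
  "limit_closed Y \<longleftrightarrow>
     (\<forall>x. (\<forall>B. finite B \<longrightarrow> (\<exists>y\<in>Y. \<forall>t\<in>B. y t = x t)) \<longrightarrow> x \<in> Y)"

lemma limit_closedD:
  "limit_closed Y \<Longrightarrow> (\<And>B. finite B \<Longrightarrow> \<exists>y\<in>Y. \<forall>t\<in>B. y t = x t) \<Longrightarrow> x \<in> Y"
  by (auto simp: limit_closed_def)

lemma dom_patch: "dom ((Some \<circ> x) |` B) = B"
  by (auto simp: dom_def restrict_map_def)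

lemma decreasing_sets_stabilise:
  assumes "\<And>m. A (Suc m) \<subseteq> A m" "\<And>m. finite (A m)"
  shows "\<exists>M. \<forall>m\<ge>M. A m = A M"
proof -
  obtain M where M: "\<And>m. card (A M) \<le> card (A m)"
    using ex_has_least_nat[of "\<lambda>_. True" 0 "\<lambda>m. card (A m)"] by blast
  have "A m = A M" if "m \<ge> M" for m
  proof (rule card_seteq[OF assms(2)])
    show "A m \<subseteq> A M"
      using lift_Suc_antimono_le[of A, OF assms(1) that] .
    show "card (A M) \<le> card (A m)" by (rule M)
  qed
  then show ?thesis by blast
qed

section \<open>Positions, digits and powers of a substitution\<close>

locale block_substitution =
  fixes l :: "int ^ 'd::finite" and \<theta> :: "'a::finite \<Rightarrow> int ^ 'd \<Rightarrow> 'a"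
  assumes expansive: "l $ i \<ge> 2"
begin

abbreviation inflate :: "nat \<Rightarrow> (int ^ 'd \<Rightarrow> 'a) \<Rightarrow> (int ^ 'd \<Rightarrow> 'a)" where
  "inflate k \<equiv> subst_conf l \<theta> ^^ k"

abbreviation X :: "(int ^ 'd \<Rightarrow> 'a) set" where
  "X \<equiv> subshift l \<theta>"

lemma side_pow_pos [simp]: "l $ i ^ k > 0"
  using expansive[of i] by simp

lemma side_pow_nonneg [simp]: "l $ i ^ k \<ge> 0"
  using side_pow_pos[of i k] by linarith

lemma side_pow_nonzero [simp]: "l $ i ^ k \<noteq> 0"
  using side_pow_pos[of i k] by linarith

lemma qmul_qdiv_qmod [simp]: "qmul l k (qdiv l k t) + qmod l k t = t"
  by (simp add: vec_eq_iff qmul_def qdiv_def qmod_def)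

lemma qmod_in_supp [simp]: "qmod l k t \<in> supp l k"
  by (simp add: qmod_def supp_def)

lemma qdiv_qmul_add [simp]: "r \<in> supp l k \<Longrightarrow> qdiv l k (qmul l k m + r) = m"
  using side_pow_nonzero
  by (simp add: vec_eq_iff qmul_def qdiv_def supp_def div_pos_pos_trivial del: side_pow_nonzero power_eq_0_iff)

lemma qmod_qmul_add [simp]: "r \<in> supp l k \<Longrightarrow> qmod l k (qmul l k m + r) = r"
  by (simp add: vec_eq_iff qmul_def qmod_def supp_def)

lemma qmod_eq_self: "r \<in> supp l k \<Longrightarrow> qmod l k r = r"
  by (simp add: vec_eq_iff qmod_def supp_def)

lemma qdiv_eq_0: "r \<in> supp l k \<Longrightarrow> qdiv l k r = 0"
  by (simp add: vec_eq_iff qdiv_def supp_def div_pos_pos_trivial)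

lemma qdiv_shift: "qdiv l k (t + qmul l k m) = qdiv l k t + m"
  using side_pow_nonzero
  by (simp add: vec_eq_iff qmul_def qdiv_def del: side_pow_nonzero power_eq_0_iff)

lemma qmod_shift: "qmod l k (t + qmul l k m) = qmod l k t"
  by (simp add: vec_eq_iff qmul_def qmod_def)

lemma qmul_0 [simp]: "qmul l 0 m = m" "qmul l k 0 = 0"
  by (simp_all add: vec_eq_iff qmul_def)

lemma qmul_add: "qmul l k (m + n) = qmul l k m + qmul l k n"
  by (simp add: vec_eq_iff qmul_def algebra_simps)

lemma qmul_diff: "qmul l k (m - n) = qmul l k m - qmul l k n"
  by (simp add: vec_eq_iff qmul_def algebra_simps)

lemma qmul_qmul: "qmul l j (qmul l k m) = qmul l (j + k) m"
  by (simp add: vec_eq_iff qmul_def power_add)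

lemma inj_qmul: "inj (qmul l k)"
  using side_pow_nonzero
  by (intro injI) (simp add: vec_eq_iff qmul_def del: side_pow_nonzero power_eq_0_iff)

lemma qdiv_qdiv: "qdiv l k (qdiv l j t) = qdiv l (j + k) t"
  by (simp add: vec_eq_iff qdiv_def power_add zdiv_zmult2_eq)

lemma qmod_qmod: "j \<le> k \<Longrightarrow> qmod l j (qmod l k t) = qmod l j t"
  by (simp add: vec_eq_iff qmod_def le_imp_power_dvd mod_mod_cancel)

lemma supp_0: "supp l 0 = {0}"
proof -
  have "0 \<le> m \<and> m < 1 \<longleftrightarrow> m = 0" for m :: int
    by linarith
  then show ?thesis
    by (simp add: supp_def set_eq_iff vec_eq_iff)
qed

lemma zero_in_supp [simp]: "0 \<in> supp l k"
  by (simp add: supp_def)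

lemma finite_box:
  fixes a b :: "'d \<Rightarrow> int"
  shows "finite {t :: int ^ 'd. \<forall>i. a i \<le> t $ i \<and> t $ i \<le> b i}" (is "finite ?B")
proof -
  have "?B \<subseteq> vec_lambda ` (PiE UNIV (\<lambda>i. {a i..b i}))"
  proof
    fix t assume "t \<in> ?B"
    then have "t = vec_lambda (vec_nth t)" "vec_nth t \<in> PiE UNIV (\<lambda>i. {a i..b i})"
      by auto
    then show "t \<in> vec_lambda ` (PiE UNIV (\<lambda>i. {a i..b i}))"
      by blast
  qed
  then show ?thesis
    by (rule finite_subset) (intro finite_imageI finite_PiE; simp)
qed

lemma finite_supp [simp]: "finite (supp l k)"
  by (rule finite_subset[OF _ finite_box[of "\<lambda>_. 0" "\<lambda>i. l $ i ^ k"]])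
     (auto simp: supp_def intro: less_imp_le)

lemma supp_scale:
  assumes "p \<in> supp l m" "r \<in> supp l k"
  shows "qmul l k p + r \<in> supp l (k + m)"
proof -
  have "0 \<le> l $ i ^ k * p $ i + r $ i \<and> l $ i ^ k * p $ i + r $ i < l $ i ^ k * l $ i ^ m" for i
  proof -
    have 1: "0 \<le> p $ i" "p $ i + 1 \<le> l $ i ^ m" "0 \<le> r $ i" "r $ i < l $ i ^ k"
      using assms by (auto simp: supp_def add1_zle_eq)
    have "l $ i ^ k * (p $ i + 1) \<le> l $ i ^ k * l $ i ^ m"
      using 1 by (intro mult_left_mono) auto
    moreover have "0 \<le> l $ i ^ k * p $ i"
      using 1 by simp
    ultimately show ?thesis
      using 1 by (simp add: algebra_simps)
  qed
  then show ?thesis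
    by (simp add: supp_def qmul_def power_add)
qed

lemma qdiv_in_supp:
  assumes "t \<in> supp l (k + m)"
  shows "qdiv l k t \<in> supp l m"
proof -
  have "0 \<le> t $ i div l $ i ^ k \<and> t $ i div l $ i ^ k < l $ i ^ m" for i
  proof -
    have "0 \<le> t $ i" "t $ i < l $ i ^ m * l $ i ^ k"
      using assms by (auto simp: supp_def power_add mult.commute)
    moreover have "t $ i div l $ i ^ k * l $ i ^ k \<le> t $ i"
      using div_mult_mod_eq[of "t $ i" "l $ i ^ k"] pos_mod_sign[OF side_pow_pos[of i k], of "t $ i"]
      by linarith
    ultimately show ?thesis
      using side_pow_pos[of i k] pos_imp_zdiv_nonneg_iff[of "l $ i ^ k" "t $ i"]
      by (metis le_less_trans mult_less_cancel_right_pos)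
  qed
  then show ?thesis
    by (simp add: supp_def qdiv_def)
qed

lemma subst_pow_add:
  assumes "r \<in> supp l k"
  shows "subst_pow l \<theta> (k + m) a (qmul l k p + r) = subst_pow l \<theta> k (subst_pow l \<theta> m a p) r"
  using assms
proof (induction k arbitrary: r)
  case 0
  then show ?case by (simp add: supp_0)
next
  case (Suc k)
  have 1: "qdiv l 1 r \<in> supp l k"
    using qdiv_in_supp[of r 1 k] Suc.prems by simp
  have *: "qmul l (Suc k) p + r = qmul l 1 (qmul l k p) + r"
    by (simp add: qmul_qmul)
  have "qdiv l 1 (qmul l (Suc k) p + r) = qmul l k p + qdiv l 1 r"
    unfolding * using qdiv_shift[of 1 r "qmul l k p"] by (simp add: add.commute)
  moreover have "qmod l 1 (qmul l (Suc k) p + r) = qmod l 1 r"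
    unfolding * using qmod_shift[of 1 r "qmul l k p"] by (simp add: add.commute)
  ultimately show ?case
    using Suc.IH[OF 1] by simp
qed

lemma inflate_eq: "inflate k x t = subst_pow l \<theta> k (x (qdiv l k t)) (qmod l k t)"
proof (induction k arbitrary: t)
  case 0
  have "qdiv l 0 t = t" by (simp add: vec_eq_iff qdiv_def)
  then show ?case by simp
next
  case (Suc k)
  have "qdiv l 1 (qmod l (Suc k) t) = qmod l k (qdiv l 1 t)"
    using expansive by (simp add: vec_eq_iff qdiv_def qmod_def zmod_zmult2_eq div_mult_self2 order.strict_implies_not_eq[OF side_pow_pos[of _ 1, simplified], symmetric])
  then show ?case
    using Suc[of "qdiv l 1 t"] qdiv_qdiv[of k 1 t] qmod_qmod[of 1 "Suc k" t]
    by (simp add: subst_conf_def)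
qed

lemma inflate_at: "r \<in> supp l k \<Longrightarrow> inflate k x (qmul l k m + r) = subst_pow l \<theta> k (x m) r"
  by (simp add: inflate_eq)

lemma shift_shift: "shift m (shift n x) = shift (m + n) x"
  by (simp add: shift_def add_ac)

lemma shift_0 [simp]: "shift 0 x = x"
  by (simp add: shift_def)

lemma inflate_shift: "inflate k (shift m x) = shift (qmul l k m) (inflate k x)"
  by (rule ext) (simp add: inflate_eq shift_def qdiv_shift qmod_shift)

lemma inflate_add: "inflate (j + k) x = inflate j (inflate k x)"
  by (simp add: funpow_add)

definition cube :: "nat \<Rightarrow> (int ^ 'd) set" where
  "cube n = {t. \<forall>i. - int n \<le> t $ i \<and> t $ i \<le> int n}"

lemma finite_cube [simp]: "finite (cube n)"
  unfolding cube_def by (rule finite_box)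

lemma cube_mono: "m \<le> n \<Longrightarrow> cube m \<subseteq> cube n"
  unfolding cube_def by (rule Collect_mono) (smt (verit) of_nat_mono)

lemma in_some_cube: "\<exists>N. \<forall>n\<ge>N. t \<in> cube n"
proof -
  define N where "N = nat (\<Sum>i\<in>UNIV. \<bar>t $ i\<bar>)"
  have "\<bar>t $ i\<bar> \<le> int N" for i
    unfolding N_def using member_le_sum[of i UNIV "\<lambda>i. \<bar>t $ i\<bar>"] by (simp add: sum_nonneg)
  then have "t \<in> cube N"
    by (simp add: cube_def abs_le_iff minus_le_iff)
  then show ?thesis
    using cube_mono by blast
qed

text \<open>A limit of points with a prescribed offset of supertiles again has this offset: a cluster point
  of their preimages is a preimage.\<close>

lemma limit_closed_inflate:
  assumes "limit_closed Y"
  shows "limit_closed ((\<lambda>y. shift j (inflate k y)) ` Y)"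
  unfolding limit_closed_def
proof (intro allI impI)
  fix x
  assume approx: "\<forall>B. finite B \<longrightarrow>
    (\<exists>y\<in>(\<lambda>y. shift j (inflate k y)) ` Y. \<forall>t\<in>B. y t = x t)"
  have "\<exists>y. y \<in> Y \<and> (\<forall>t\<in>cube n. shift j (inflate k y) t = x t)" for n
    using approx[rule_format, of "cube n"] by auto
  then obtain y where y: "\<And>n. y n \<in> Y"
      and yx: "\<And>n t. t \<in> cube n \<Longrightarrow> shift j (inflate k (y n)) t = x t"
    by metis
  obtain u where u: "\<And>B N. finite B \<Longrightarrow> \<exists>n\<ge>N. \<forall>t\<in>B. y n t = u t"
    using cluster_point[of y] by metis
  have "u \<in> Y"
  proof (rule limit_closedD[OF assms])
    show "\<exists>v\<in>Y. \<forall>t\<in>B. v t = u t" if "finite B" for B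
      using u[OF that, of 0] y by blast
  qed
  moreover have "x t = shift j (inflate k u) t" for t
  proof -
    obtain N where N: "\<And>n. n \<ge> N \<Longrightarrow> t \<in> cube n"
      using in_some_cube by blast
    obtain n where n: "n \<ge> N" "y n (qdiv l k (t + j)) = u (qdiv l k (t + j))"
      using u[of "{qdiv l k (t + j)}" N] by auto
    from yx[OF N[OF n(1)]] n(2) show ?thesis
      by (simp add: shift_def inflate_eq)
  qed
  then have "x = shift j (inflate k u)"
    by blast
  ultimately show "x \<in> (\<lambda>y. shift j (inflate k y)) ` Y"
    by blast
qed

section \<open>The subshift\<close>

lemma legal_patch_iff:
  "legal l \<theta> ((Some \<circ> x) |` B) \<longleftrightarrow>
    finite B \<and> (\<exists>k a t. \<forall>i\<in>B. i + t \<in> supp l k \<and> x i = subst_pow l \<theta> k a (i + t))"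
  unfolding legal_def dom_patch by simp

lemma subshift_iff:
  "x \<in> X \<longleftrightarrow> (\<forall>B. finite B \<longrightarrow>
     (\<exists>k a t. \<forall>i\<in>B. i + t \<in> supp l k \<and> x i = subst_pow l \<theta> k a (i + t)))"
  by (simp add: subshift_def legal_patch_iff)

lemma subshiftE:
  assumes "x \<in> X" "finite B"
  obtains k a t where "\<And>i. i \<in> B \<Longrightarrow> i + t \<in> supp l k"
    "\<And>i. i \<in> B \<Longrightarrow> x i = subst_pow l \<theta> k a (i + t)"
  using assms unfolding subshift_iff by metis

lemma limit_closed_subshift: "limit_closed X"
  unfolding limit_closed_def
proof (intro allI impI)
  fix x
  assume approx: "\<forall>B. finite B \<longrightarrow> (\<exists>y\<in>X. \<forall>t\<in>B. y t = x t)"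
  show "x \<in> X"
    unfolding subshift_iff
  proof (intro allI impI)
    fix B :: "(int ^ 'd) set" assume B: "finite B"
    then obtain y where "y \<in> X" and y: "\<forall>t\<in>B. y t = x t"
      using approx by blast
    then obtain k a t where "\<forall>i\<in>B. i + t \<in> supp l k \<and> y i = subst_pow l \<theta> k a (i + t)"
      using B unfolding subshift_iff by blast
    with y show "\<exists>k a t. \<forall>i\<in>B. i + t \<in> supp l k \<and> x i = subst_pow l \<theta> k a (i + t)"
      by metis
  qed
qed

lemma shift_in_subshift:
  assumes "x \<in> X"
  shows "shift n x \<in> X"
  unfolding subshift_iff
proof (intro allI impI)
  fix B :: "(int ^ 'd) set" assume "finite B"
  then have "finite ((\<lambda>i. i + n) ` B)" by simp
  then obtain k a t where "\<And>i. i \<in> (\<lambda>i. i + n) ` B \<Longrightarrow> i + t \<in> supp l k"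
      "\<And>i. i \<in> (\<lambda>i. i + n) ` B \<Longrightarrow> x i = subst_pow l \<theta> k a (i + t)"
    using subshiftE[OF assms] by metis
  from this[OF imageI] have "\<forall>i\<in>B. i + (n + t) \<in> supp l k \<and> shift n x i = subst_pow l \<theta> k a (i + (n + t))"
    by (simp add: shift_def add.assoc)
  then show "\<exists>k a t. \<forall>i\<in>B. i + t \<in> supp l k \<and> shift n x i = subst_pow l \<theta> k a (i + t)"
    by blast
qed

lemma inflate_in_subshift:
  assumes "x \<in> X"
  shows "inflate k x \<in> X"
  unfolding subshift_iff
proof (intro allI impI)
  fix B :: "(int ^ 'd) set" assume "finite B"
  then have "finite (qdiv l k ` B)" by simp
  then obtain m a t where t: "\<And>i. i \<in> B \<Longrightarrow> qdiv l k i + t \<in> supp l m"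
      "\<And>i. i \<in> B \<Longrightarrow> x (qdiv l k i) = subst_pow l \<theta> m a (qdiv l k i + t)"
    using subshiftE[OF assms, of "qdiv l k ` B"] by (metis imageI)
  have *: "i + qmul l k t = qmul l k (qdiv l k i + t) + qmod l k i" for i
    using qmul_qdiv_qmod[of k i] by (simp add: qmul_add algebra_simps)
  have "i + qmul l k t \<in> supp l (k + m) \<and>
      inflate k x i = subst_pow l \<theta> (k + m) a (i + qmul l k t)" if "i \<in> B" for i
    unfolding * using t[OF that] by (simp add: supp_scale subst_pow_add inflate_eq)
  then show "\<exists>k' a t. \<forall>i\<in>B. i + t \<in> supp l k' \<and> inflate k x i = subst_pow l \<theta> k' a (i + t)"
    by blast
qed

text \<open>Large legal patches lie inside supertiles and hence have preimages; a cluster point of these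
  preimages desubstitutes the whole configuration.\<close>

lemma desubstitute_once:
  assumes x: "x \<in> X"
  shows "\<exists>j\<in>supp l 1. \<exists>y\<in>X. x = shift j (inflate 1 y)"
proof -
  define good where "good n j k a m \<longleftrightarrow> (\<forall>i\<in>cube n. qdiv l 1 (i + j) + m \<in> supp l k \<and>
    x i = \<theta> (subst_pow l \<theta> k a (qdiv l 1 (i + j) + m)) (qmod l 1 (i + j)))" for n j k a m
  have "\<exists>j\<in>supp l 1. \<exists>k a m. good n j k a m" if "n \<ge> 1" for n
  proof -
    obtain k a t where t: "\<And>i. i \<in> cube n \<Longrightarrow> i + t \<in> supp l k"
        "\<And>i. i \<in> cube n \<Longrightarrow> x i = subst_pow l \<theta> k a (i + t)"
      using subshiftE[OF x finite_cube[of n]] by metis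
    \<comment> \<open>\<open>\<theta>\<^sup>0(a)\<close> is a single letter, whereas the cube has at least two positions\<close>
    have "k \<noteq> 0"
    proof
      assume "k = 0"
      moreover have "0 \<in> cube n" "1 \<in> cube n"
        using that by (auto simp: cube_def)
      ultimately have "(1 :: int ^ 'd) = 0"
        using t(1)[of 0] t(1)[of 1] by (simp add: supp_0)
      then show False by simp
    qed
    then obtain k' where k: "k = Suc k'"
      using not0_implies_Suc by blast
    define j m where "j = qmod l 1 t" and "m = qdiv l 1 t"
    have *: "i + t = (i + j) + qmul l 1 m" for i
      using qmul_qdiv_qmod[of 1 t] by (simp add: j_def m_def algebra_simps)
    have "good n j k' a m"
      unfolding good_def
    proof
      fix i assume i: "i \<in> cube n"
      have "qdiv l 1 (i + t) \<in> supp l k'"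
        using t(1)[OF i] qdiv_in_supp[of "i + t" 1 k'] by (simp add: k)
      moreover have "x i = \<theta> (subst_pow l \<theta> k' a (qdiv l 1 (i + t))) (qmod l 1 (i + t))"
        using t(2)[OF i] by (simp add: k)
      ultimately show "qdiv l 1 (i + j) + m \<in> supp l k' \<and>
          x i = \<theta> (subst_pow l \<theta> k' a (qdiv l 1 (i + j) + m)) (qmod l 1 (i + j))"
        unfolding * qdiv_shift qmod_shift by simp
    qed
    moreover have "j \<in> supp l 1"
      by (simp add: j_def)
    ultimately show ?thesis by blast
  qed
  then have ex: "\<exists>j\<in>supp l 1. \<exists>k a m. good (Suc n) j k a m" for n
    by simp
  have anti: "good n' j k a m" if "good n j k a m" "n' \<le> n" for n n' j k a m
    using that cube_mono[of n' n] by (auto simp: good_def)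
  obtain j where j: "j \<in> supp l 1" "\<And>n. \<exists>k a m. good n j k a m"
  proof -
    have "\<exists>j\<in>supp l 1. infinite {n\<in>UNIV. \<exists>k a m. good (Suc n) j k a m}"
      using ex by (intro pigeonhole_infinite_rel) auto
    then obtain j where j: "j \<in> supp l 1" "infinite {n. \<exists>k a m. good (Suc n) j k a m}"
      by auto
    have "\<exists>k a m. good n j k a m" for n
    proof -
      obtain n' where "n' \<ge> n" "\<exists>k a m. good (Suc n') j k a m"
        using j(2) unfolding infinite_nat_iff_unbounded_le by blast
      then show ?thesis
        using anti[of "Suc n'" j _ _ _ n] by (meson le_SucI)
    qed
    with j(1) that show thesis by blast
  qed
  obtain K A M where good: "\<And>n. good n j (K n) (A n) (M n)"
    using j(2) by metis
  define y where "y n = (\<lambda>p. subst_pow l \<theta> (K n) (A n) (p + M n))" for n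
  obtain u where u: "\<And>B N. finite B \<Longrightarrow> \<exists>n\<ge>N. \<forall>t\<in>B. y n t = u t"
    using cluster_point[of y] by metis
  have "x t = shift j (inflate 1 u) t" for t
  proof -
    obtain N where N: "\<And>n. n \<ge> N \<Longrightarrow> t \<in> cube n"
      using in_some_cube by blast
    obtain n where n: "n \<ge> N" "y n (qdiv l 1 (t + j)) = u (qdiv l 1 (t + j))"
      using u[of "{qdiv l 1 (t + j)}" N] by auto
    have "x t = \<theta> (y n (qdiv l 1 (t + j))) (qmod l 1 (t + j))"
      using good[of n] N[OF n(1)] by (auto simp: good_def y_def)
    then show ?thesis
      using n(2) by (simp add: shift_def subst_conf_def)
  qed
  then have "x = shift j (inflate 1 u)" by blast
  moreover have "u \<in> X"
    unfolding subshift_iff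
  proof (intro allI impI)
    fix B :: "(int ^ 'd) set" assume B: "finite B"
    have "\<forall>p\<in>B. \<exists>N. \<forall>n\<ge>N. qmul l 1 p - j \<in> cube n"
      using in_some_cube by blast
    then obtain N where N: "\<And>p n. p \<in> B \<Longrightarrow> N p \<le> n \<Longrightarrow> qmul l 1 p - j \<in> cube n"
      by metis
    obtain n where n: "n \<ge> (\<Sum>p\<in>B. N p)" "\<forall>p\<in>B. y n p = u p"
      using u[OF B] by metis
    have "p + M n \<in> supp l (K n) \<and> u p = subst_pow l \<theta> (K n) (A n) (p + M n)" if "p \<in> B" for p
    proof -
      have "N p \<le> n"
        using member_le_sum[OF that _ B, of N] n(1) by simp
      then have "qdiv l 1 ((qmul l 1 p - j) + j) + M n \<in> supp l (K n)"
        using good[of n] N[OF that] by (simp only: good_def)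
      then show ?thesis
        using n(2) that qdiv_qmul_add[of 0 1 p] by (simp add: y_def)
    qed
    then show "\<exists>k a t. \<forall>i\<in>B. i + t \<in> supp l k \<and> u i = subst_pow l \<theta> k a (i + t)"
      by blast
  qed
  ultimately show ?thesis
    using j(1) by blast
qed

lemma desubstitute:
  assumes "x \<in> X"
  shows "\<exists>j\<in>supp l k. \<exists>y\<in>X. x = shift j (inflate k y)"
  using assms
proof (induction k arbitrary: x)
  case 0
  then show ?case by (auto simp: supp_0)
next
  case (Suc k)
  obtain j y where j: "j \<in> supp l 1" "y \<in> X" "x = shift j (inflate 1 y)"
    using desubstitute_once[OF Suc.prems] by blast
  obtain i w where i: "i \<in> supp l k" "w \<in> X" "y = shift i (inflate k w)"
    using Suc.IH[OF j(2)] by blast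
  have "x = shift (qmul l 1 i + j) (inflate (Suc k) w)"
    unfolding j(3) i(3) inflate_shift shift_shift
    using inflate_add[of 1 k w] by (simp add: add.commute)
  moreover have "qmul l 1 i + j \<in> supp l (Suc k)"
    using supp_scale[OF i(1) j(1)] by simp
  ultimately show ?case
    using i(2) by blast
qed

end

locale aperiodic_substitution = block_substitution l \<theta>
  for l :: "int ^ 'd::finite" and \<theta> :: "'a::finite \<Rightarrow> int ^ 'd \<Rightarrow> 'a" +
  assumes injective: "injective_subst l \<theta>"
    and primitive: "primitive_subst l \<theta>"
    and aperiodic: "aperiodic_subst l \<theta>"
    and nonempty: "subshift l \<theta> \<noteq> {}"
begin

lemma letter_occurs:
  obtains k where "\<And>s a b. k \<le> s \<Longrightarrow> \<exists>p\<in>supp l s. subst_pow l \<theta> s a p = b"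
proof -
  obtain k where k: "\<And>a. subst_pow l \<theta> k a ` supp l k = UNIV"
    using primitive by (auto simp: primitive_subst_def)
  have "\<exists>p\<in>supp l s. subst_pow l \<theta> s a p = b" if "k \<le> s" for s a b
  proof -
    have "b \<in> subst_pow l \<theta> k (subst_pow l \<theta> (s - k) a 0) ` supp l k"
      by (simp add: k)
    then obtain p where p: "p \<in> supp l k" "subst_pow l \<theta> k (subst_pow l \<theta> (s - k) a 0) p = b"
      by blast
    have "p \<in> supp l s"
      using supp_scale[OF zero_in_supp p(1), of "s - k"] that by simp
    moreover have "subst_pow l \<theta> s a p = b"
      using subst_pow_add[OF p(1), of "s - k" a 0] p(2) that by simp
    ultimately show ?thesis by blast
  qed
  then show thesis
    using that by blast
qed

text \<open>A legal patch lies in some \<open>\<theta>\<^sup>k(b)\<close>, and \<open>b\<close> lies in every \<open>\<theta>\<^sup>s(a)\<close> for large \<open>s\<close>. As there are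
  finitely many patches on a finite support, \<open>s\<close> can be chosen for all of them at once.\<close>

lemma uniform_recurrence:
  assumes B: "finite B"
  obtains s where "\<And>a x. x \<in> X \<Longrightarrow>
    \<exists>t. \<forall>i\<in>B. i + t \<in> supp l s \<and> x i = subst_pow l \<theta> s a (i + t)"
proof -
  define occ where "occ s f \<longleftrightarrow>
    (\<forall>a. \<exists>t. \<forall>i\<in>B. i + t \<in> supp l s \<and> f i = subst_pow l \<theta> s a (i + t))"
    for s and f :: "int ^ 'd \<Rightarrow> 'a"
  have one: "\<exists>s0. \<forall>s\<ge>s0. occ s x" if x: "x \<in> X" for x
  proof -
    obtain k b t where t: "\<And>i. i \<in> B \<Longrightarrow> i + t \<in> supp l k"
        "\<And>i. i \<in> B \<Longrightarrow> x i = subst_pow l \<theta> k b (i + t)"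
      using subshiftE[OF x B] by metis
    obtain k0 where k0: "\<And>s a b. k0 \<le> s \<Longrightarrow> \<exists>p\<in>supp l s. subst_pow l \<theta> s a p = b"
      using letter_occurs by metis
    have "occ s x" if s: "s \<ge> k + k0" for s
      unfolding occ_def
    proof
      fix a
      obtain p where p: "p \<in> supp l (s - k)" "subst_pow l \<theta> (s - k) a p = b"
        using k0[of "s - k"] s by fastforce
      have "i + (qmul l k p + t) \<in> supp l s \<and> x i = subst_pow l \<theta> s a (i + (qmul l k p + t))"
        if "i \<in> B" for i
      proof -
        have *: "i + (qmul l k p + t) = qmul l k p + (i + t)"
          by (simp add: algebra_simps)
        show ?thesis
          unfolding * using supp_scale[OF p(1) t(1)[OF that]] subst_pow_add[OF t(1)[OF that], of "s - k" a p] p(2) t(2)[OF that] s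
          by simp
      qed
      then show "\<exists>t. \<forall>i\<in>B. i + t \<in> supp l s \<and> x i = subst_pow l \<theta> s a (i + t)"
        by blast
    qed
    then show ?thesis by blast
  qed
  define F where "F = (\<lambda>x. restrict x B) ` X"
  have "F \<subseteq> PiE B (\<lambda>_. UNIV)"
    by (auto simp: F_def)
  then have "finite F"
    by (rule finite_subset) (use B in \<open>auto intro: finite_PiE\<close>)
  have occ_restrict: "occ s (restrict x B) \<longleftrightarrow> occ s x" for s x
    by (simp add: occ_def)
  have "\<forall>f\<in>F. \<exists>s0. \<forall>s\<ge>s0. occ s f"
    using one by (auto simp: F_def occ_restrict)
  then obtain s0 where s0: "\<And>f s. f \<in> F \<Longrightarrow> s0 f \<le> s \<Longrightarrow> occ s f"
    by metis
  define s where "s = (\<Sum>f\<in>F. s0 f)"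
  have "occ s x" if "x \<in> X" for x
  proof -
    have "restrict x B \<in> F"
      using that by (auto simp: F_def)
    then have "occ s (restrict x B)"
      using s0[of "restrict x B" s] member_le_sum[of "restrict x B" F s0] \<open>finite F\<close>
      by (simp add: s_def)
    then show ?thesis
      by (simp add: occ_restrict)
  qed
  then show thesis
    unfolding occ_def by (intro that[of s]) simp
qed

lemma recurrent:
  assumes "w \<in> X" "y \<in> X" "finite B"
  shows "\<exists>m. \<forall>i\<in>B. shift m y i = w i"
proof -
  obtain s where s: "\<And>a x. x \<in> X \<Longrightarrow>
      \<exists>t. \<forall>i\<in>B. i + t \<in> supp l s \<and> x i = subst_pow l \<theta> s a (i + t)"
    using uniform_recurrence[OF assms(3)] by metis
  obtain j u where y: "y = shift j (inflate s u)"
    using desubstitute[OF assms(2), of s] by blast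
  obtain t where t: "\<forall>i\<in>B. i + t \<in> supp l s \<and> w i = subst_pow l \<theta> s (u 0) (i + t)"
    using s[OF assms(1)] by blast
  have "shift (t - j) y i = w i" if "i \<in> B" for i
    using t that unfolding y shift_shift
    by (simp add: shift_def inflate_eq qdiv_eq_0 qmod_eq_self)
  then show ?thesis by blast
qed

lemma legal_patches:
  assumes B: "finite B"
  shows "lang l \<theta> B = (\<lambda>x. (Some \<circ> x) |` B) ` X"
proof
  show "(\<lambda>x. (Some \<circ> x) |` B) ` X \<subseteq> lang l \<theta> B"
  proof (rule image_subsetI)
    fix x assume "x \<in> X"
    then show "(Some \<circ> x) |` B \<in> lang l \<theta> B"
      unfolding lang_def subshift_def mem_Collect_eq dom_patch using B by simp
  qed
next
  show "lang l \<theta> B \<subseteq> (\<lambda>x. (Some \<circ> x) |` B) ` X"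
  proof
    fix P assume "P \<in> lang l \<theta> B"
    then obtain k a t where P: "dom P = B"
        "\<forall>i\<in>dom P. i + t \<in> supp l k \<and> P i = Some (subst_pow l \<theta> k a (i + t))"
      unfolding lang_def legal_def by blast
    note P = P(1) P(2)[unfolded P(1), rule_format]
    obtain s where s: "\<And>s' b c. s \<le> s' \<Longrightarrow> \<exists>p\<in>supp l s'. subst_pow l \<theta> s' b p = c"
      using letter_occurs by metis
    obtain x where x: "x \<in> X"
      using nonempty by blast
    obtain p where p: "p \<in> supp l s" "subst_pow l \<theta> s (x 0) p = a"
      using s by blast
    define y where "y = shift (qmul l k p + t) (inflate k (inflate s x))"
    have "y \<in> X"
      unfolding y_def by (intro shift_in_subshift inflate_in_subshift x)
    moreover have "P i = ((Some \<circ> y) |` B) i" for i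
    proof (cases "i \<in> B")
      case True
      have "y i = inflate k (inflate s x) (qmul l k p + (i + t))"
        by (simp add: y_def shift_def algebra_simps)
      also have "\<dots> = subst_pow l \<theta> k a (i + t)"
        using P(2)[OF True] p inflate_at[of p s x 0] by (simp add: inflate_at)
      finally show ?thesis
        using P(2) True by simp
    next
      case False
      then show ?thesis
        using P(1) by (auto simp: dom_def)
    qed
    then have "P = (Some \<circ> y) |` B" by blast
    ultimately show "P \<in> (\<lambda>x. (Some \<circ> x) |` B) ` X" by blast
  qed
qed

section \<open>Recognisability\<close>

lemma inj_inflate: "inj (inflate k)"
proof -
  have one: "x = y" if "inflate 1 x = inflate 1 y" for x y
  proof
    fix m
    have "\<theta> (x m) r = \<theta> (y m) r" if "r \<in> supp l 1" for r
    proof -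
      have "subst_pow l \<theta> 1 (x m) r = subst_pow l \<theta> 1 (y m) r"
        using \<open>inflate 1 x = inflate 1 y\<close> inflate_at[OF that, of x m] inflate_at[OF that, of y m]
        by simp
      then show ?thesis
        using qmod_eq_self[OF that] by simp
    qed
    then have "restrict (\<theta> (x m)) (supp l 1) = restrict (\<theta> (y m)) (supp l 1)"
      by (simp add: restrict_def fun_eq_iff)
    then show "x m = y m"
      using injective by (auto simp: injective_subst_def dest: injD)
  qed
  then have "inj (subst_conf l \<theta>)"
    by (simp add: inj_on_def)
  then show ?thesis
    by (induction k) (auto intro: inj_compose)
qed

text \<open>The possible offsets between two tilings of one configuration by supertiles of level \<open>n\<close>.
  Recognisability says that they are multiples of \<open>Q\<^sup>n\<close>.\<close>

definition offsets :: "nat \<Rightarrow> (int ^ 'd) set" where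
  "offsets n = {u. \<exists>y\<in>X. \<exists>y'\<in>X. inflate n y = shift u (inflate n y')}"

lemma shift_swap: "shift u x = y \<longleftrightarrow> x = shift (- u) y"
  by (auto simp: shift_shift)

lemma offsets_add_qmul:
  assumes "u \<in> offsets n"
  shows "u + qmul l n m \<in> offsets n"
proof -
  obtain y y' where y: "y \<in> X" "y' \<in> X" "inflate n y = shift u (inflate n y')"
    using assms by (auto simp: offsets_def)
  have "inflate n y = shift (u + qmul l n m) (inflate n (shift (- m) y'))"
    using qmul_add[of n m "- m"] by (simp add: y inflate_shift shift_shift add.assoc)
  then show ?thesis
    using y shift_in_subshift[OF y(2)] by (auto simp: offsets_def)
qed

lemma offsets_scale:
  assumes "u \<in> offsets n"
  shows "qmul l 1 u \<in> offsets (Suc n)"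
proof -
  obtain y y' where y: "y \<in> X" "y' \<in> X" "inflate n y = shift u (inflate n y')"
    using assms by (auto simp: offsets_def)
  have "inflate (1 + n) y = shift (qmul l 1 u) (inflate (1 + n) y')"
    unfolding inflate_add y(3) inflate_shift ..
  then show ?thesis
    using y(1,2) unfolding offsets_def plus_1_eq_Suc by blast
qed

text \<open>Desubstituting the two configurations that \<open>u\<close> compares produces the correction \<open>j\<close>. This
  carries divisibility from high levels down to level \<open>n\<close>.\<close>

lemma offsets_refine:
  assumes "u \<in> offsets n"
  shows "\<exists>j. u + qmul l n j \<in> offsets (n + s)"
proof -
  obtain y y' where y: "y \<in> X" "y' \<in> X" "inflate n y = shift u (inflate n y')"
    using assms by (auto simp: offsets_def)
  obtain i a where a: "a \<in> X" "y = shift i (inflate s a)"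
    using desubstitute[OF y(1), of s] by blast
  obtain j b where b: "b \<in> X" "y' = shift j (inflate s b)"
    using desubstitute[OF y(2), of s] by blast
  have "shift (qmul l n i) (inflate (n + s) a) = shift (u + qmul l n j) (inflate (n + s) b)"
    using y(3) unfolding a(2) b(2) inflate_shift inflate_add shift_shift .
  then have "inflate (n + s) a = shift (u + qmul l n (j - i)) (inflate (n + s) b)"
    unfolding shift_swap shift_shift by (simp add: qmul_diff algebra_simps)
  then show ?thesis
    using a b by (auto simp: offsets_def)
qed

text \<open>By recurrence and compactness an offset does not depend on the configuration in which it is
  observed.\<close>

lemma offset_everywhere:
  assumes "u \<in> offsets n" "w \<in> X"
  shows "\<exists>w'\<in>X. inflate n w = shift u (inflate n w')"
proof -
  obtain y y' where y: "y \<in> X" "y' \<in> X" "inflate n y = shift u (inflate n y')"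
    using assms by (auto simp: offsets_def)
  have "inflate n w \<in> (\<lambda>v. shift u (inflate n v)) ` X"
  proof (rule limit_closedD[OF limit_closed_inflate[OF limit_closed_subshift]])
    fix B :: "(int ^ 'd) set" assume "finite B"
    then obtain m where m: "\<forall>i\<in>qdiv l n ` B. shift m y i = w i"
      using recurrent[OF assms(2) y(1), of "qdiv l n ` B"] by auto
    have "inflate n (shift m y) = shift u (inflate n (shift m y'))"
      by (simp add: inflate_shift y(3) shift_shift add.commute)
    moreover have "inflate n (shift m y) t = inflate n w t" if "t \<in> B" for t
      using m that by (simp add: inflate_eq)
    ultimately show "\<exists>v\<in>(\<lambda>v. shift u (inflate n v)) ` X. \<forall>t\<in>B. v t = inflate n w t"
      using shift_in_subshift[OF y(2)] by force
  qed
  then show ?thesis by blast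
qed

text \<open>Two positions of a configuration that differ by \<open>v\<close> lie in supertiles of level \<open>q\<close> that touch.
  The letters of these two supertiles occur next to each other in \<open>\<theta>\<^sup>s(a)\<close>, so the two positions
  have copies inside the supertile of \<open>a\<close> of level \<open>q + s\<close>, where the symbols agree. Hence \<open>v\<close> is a
  period.\<close>

lemma short_translation_trivial:
  assumes s: "\<And>a x. x \<in> X \<Longrightarrow>
      \<exists>t. \<forall>i\<in>cube 1. i + t \<in> supp l s \<and> x i = subst_pow l \<theta> s a (i + t)"
    and v: "\<And>i. \<bar>v $ i\<bar> < l $ i ^ q"
    and a: "\<And>r. r \<in> supp l (q + s) \<Longrightarrow> r + v \<in> supp l (q + s) \<Longrightarrow>
      subst_pow l \<theta> (q + s) a r = subst_pow l \<theta> (q + s) a (r + v)"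
  shows "v = 0"
proof -
  obtain x where x: "x \<in> X"
    using nonempty by blast
  obtain j y where y: "y \<in> X" "x = shift j (inflate q y)"
    using desubstitute[OF x, of q] by blast
  have "x t = x (t + v)" for t
  proof -
    define r m d where "r = t + j" and "m = qdiv l q r" and "d = qdiv l q (r + v) - m"
    have "d \<in> cube 1"
    proof -
      have "-1 \<le> d $ i \<and> d $ i \<le> 1" for i
      proof -
        have *: "\<bar>v $ i\<bar> < l $ i ^ q" by (rule v)
        have 1: "(r $ i + v $ i) div l $ i ^ q \<le> (r $ i + 1 * l $ i ^ q) div l $ i ^ q"
          by (rule zdiv_mono1) (use * in auto)
        have 2: "(r $ i + (-1) * l $ i ^ q) div l $ i ^ q \<le> (r $ i + v $ i) div l $ i ^ q"
          by (rule zdiv_mono1) (use * in auto)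
        have "(r $ i + c * l $ i ^ q) div l $ i ^ q = c + r $ i div l $ i ^ q" for c
          using div_mult_self1[OF side_pow_nonzero[of i q]] .
        from 1[unfolded this] 2[unfolded this] show ?thesis
          by (simp add: d_def m_def qdiv_def)
      qed
      then show ?thesis
        by (simp add: cube_def)
    qed
    obtain p where p: "\<And>i. i \<in> cube 1 \<Longrightarrow> i + p \<in> supp l s"
        "\<And>i. i \<in> cube 1 \<Longrightarrow> shift m y i = subst_pow l \<theta> s a (i + p)"
      using s[OF shift_in_subshift[OF y(1)], of m a] by blast
    have 0: "0 \<in> cube 1"
      by (simp add: cube_def)
    define e where "e = qmul l q p + qmod l q r"
    have e: "e \<in> supp l (q + s)"
      using p(1)[OF 0] by (simp add: e_def supp_scale)
    have "r + v = qmul l q (d + m) + qmod l q (r + v)"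
      using qmul_qdiv_qmod[of q "r + v"] by (simp add: d_def)
    then have "qmul l q m + (qmul l q d + qmod l q (r + v)) = r + v"
      unfolding qmul_add by (simp add: ac_simps)
    also have "\<dots> = qmul l q m + (qmod l q r + v)"
      unfolding add.assoc[symmetric] m_def qmul_qdiv_qmod ..
    finally have "qmul l q d + qmod l q (r + v) = qmod l q r + v"
      by simp
    then have ev: "e + v = qmul l q (d + p) + qmod l q (r + v)"
      unfolding e_def qmul_add by (simp add: ac_simps)
    have ev': "e + v \<in> supp l (q + s)"
      unfolding ev by (rule supp_scale[OF p(1)[OF \<open>d \<in> cube 1\<close>]]) simp
    have "x t = subst_pow l \<theta> q (y m) (qmod l q r)"
      by (simp add: y(2) shift_def inflate_eq r_def m_def)
    also have "\<dots> = subst_pow l \<theta> (q + s) a e"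
      unfolding e_def using subst_pow_add[of "qmod l q r" q s a p] p(2)[OF 0]
      by (simp add: shift_def)
    also have "\<dots> = subst_pow l \<theta> (q + s) a (e + v)"
      using a[OF e ev'] .
    also have "\<dots> = subst_pow l \<theta> q (y (d + m)) (qmod l q (r + v))"
      unfolding ev using subst_pow_add[of "qmod l q (r + v)" q s a "d + p"] p(2)[OF \<open>d \<in> cube 1\<close>]
      by (simp add: shift_def)
    also have "\<dots> = x (t + v)"
      by (simp add: y(2) shift_def inflate_eq r_def d_def add_ac)
    finally show ?thesis .
  qed
  then have "shift v x = x"
    by (auto simp: shift_def)
  then show ?thesis
    using aperiodic x by (auto simp: aperiodic_subst_def)
qed

lemma offsets_bounded: "\<exists>K s. \<forall>n\<ge>s. card (offsets n \<inter> supp l n) \<le> K"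
proof -
  obtain s where s: "\<And>a x. x \<in> X \<Longrightarrow>
      \<exists>t. \<forall>i\<in>cube 1. i + t \<in> supp l s \<and> x i = subst_pow l \<theta> s a (i + t)"
    using uniform_recurrence[OF finite_cube[of 1]] by metis
  obtain x where x: "x \<in> X"
    using nonempty by blast
  have "card (offsets n \<inter> supp l n) \<le> card (supp l s \<times> (UNIV :: 'a set))" if "s \<le> n" for n
  proof -
    define q where "q = n - s"
    have n: "n = q + s"
      using that by (simp add: q_def)
    obtain y where y: "\<And>u. u \<in> offsets n \<Longrightarrow> inflate n x = shift u (inflate n (y u))"
      using offset_everywhere[OF _ x, of _ n] by metis
    \<comment> \<open>offsets in the same subtile of level \<open>q\<close> differ by less than its size, and equal letters at
      \<open>0\<close> make their difference a translation that preserves one supertile\<close>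
    have "inj_on (\<lambda>u. (qdiv l q u, y u 0)) (offsets n \<inter> supp l n)"
    proof (rule inj_onI)
      fix u u' assume u: "u \<in> offsets n \<inter> supp l n" "u' \<in> offsets n \<inter> supp l n"
        and eq: "(qdiv l q u, y u 0) = (qdiv l q u', y u' 0)"
      have letter: "inflate n x (r - w) = subst_pow l \<theta> n (y w 0) r"
        if "w \<in> offsets n" "r \<in> supp l n" for w r
        using that by (simp add: y[OF that(1)] shift_def inflate_eq qdiv_eq_0 qmod_eq_self)
      have "u' - u = 0"
      proof (rule short_translation_trivial[OF s, where q = q and a = "y u 0"])
        have 1: "qmod l q u' - qmod l q u = u' - u"
        proof -
          have "u' - u = (qmul l q (qdiv l q u') + qmod l q u') - (qmul l q (qdiv l q u) + qmod l q u)"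
            by simp
          then show ?thesis
            using eq by (simp del: qmul_qdiv_qmod)
        qed
        show "\<bar>(u' - u) $ i\<bar> < l $ i ^ q" for i
        proof -
          have "0 \<le> qmod l q u $ i" "qmod l q u $ i < l $ i ^ q"
               "0 \<le> qmod l q u' $ i" "qmod l q u' $ i < l $ i ^ q"
            using qmod_in_supp[of q u] qmod_in_supp[of q u'] by (auto simp: supp_def)
          then show ?thesis
            unfolding 1[symmetric] by (simp add: abs_less_iff)
        qed
        fix r assume r: "r \<in> supp l (q + s)" "r + (u' - u) \<in> supp l (q + s)"
        have "r + (u' - u) - u' = r - u"
          by (simp add: algebra_simps)
        then show "subst_pow l \<theta> (q + s) (y u 0) r = subst_pow l \<theta> (q + s) (y u 0) (r + (u' - u))"
          using letter[of u r] letter[of u' "r + (u' - u)"] u r eq n by simp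
      qed
      then show "u = u'" by simp
    qed
    moreover have "(\<lambda>u. (qdiv l q u, y u 0)) ` (offsets n \<inter> supp l n) \<subseteq> supp l s \<times> UNIV"
      using qdiv_in_supp[of _ q s] n by auto
    ultimately show ?thesis
      by (intro card_inj_on_le) auto
  qed
  then show ?thesis by blast
qed

text \<open>Multiplication by \<open>Q\<close> embeds the offsets of level \<open>n\<close>, counted modulo \<open>Q\<^sup>n\<close>, into those of
  level \<open>n + 1\<close>. As their number is bounded, the embedding is onto from some level on, so offsets of
  high level are divisible by high powers of \<open>Q\<close>.\<close>

lemma offsets_divisible: "\<exists>N. \<forall>t. \<forall>u\<in>offsets (N + t). qmod l t u = 0"
proof -
  define f where "f n = card (offsets n \<inter> supp l n)" for n
  have sub: "qmul l 1 ` (offsets n \<inter> supp l n) \<subseteq> offsets (Suc n) \<inter> supp l (Suc n)" for n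
    using offsets_scale supp_scale[of _ n 0 1] by fastforce
  have card_eq: "card (qmul l 1 ` (offsets n \<inter> supp l n)) = f n" for n
    unfolding f_def by (rule card_image) (meson inj_qmul inj_on_subset subset_UNIV)
  have mono: "f n \<le> f (Suc n)" for n
    using card_mono[OF _ sub[of n]] card_eq[of n] by (simp add: f_def)
  obtain K s where K: "\<And>n. s \<le> n \<Longrightarrow> f n \<le> K"
    using offsets_bounded by (auto simp: f_def)
  have "finite (f ` {s..})"
    by (rule finite_subset[of _ "{..K}"]) (use K in auto)
  then obtain N where N: "s \<le> N" "\<And>n. s \<le> n \<Longrightarrow> f n \<le> f N"
  proof -
    have "Max (f ` {s..}) \<in> f ` {s..}"
      using \<open>finite (f ` {s..})\<close> by (intro Max_in) auto
    then obtain N where "s \<le> N" "Max (f ` {s..}) = f N" by auto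
    moreover have "f n \<le> Max (f ` {s..})" if "s \<le> n" for n
      using \<open>finite (f ` {s..})\<close> that by (intro Max_ge) auto
    ultimately show thesis
      using that by metis
  qed
  have const: "f n = f N" if "N \<le> n" for n
    using N that lift_Suc_mono_le[of f, OF mono, of N n] by (simp add: order.antisym)
  have onto: "qmul l 1 ` (offsets n \<inter> supp l n) = offsets (Suc n) \<inter> supp l (Suc n)" if "N \<le> n" for n
    by (rule card_subset_eq[OF _ sub])
       (use card_eq[of n] const[OF that] const[of "Suc n"] that in \<open>simp_all add: f_def\<close>)
  have div: "u \<in> qmul l t ` UNIV" if "u \<in> offsets (N + t) \<inter> supp l (N + t)" for u t
    using that
  proof (induction t arbitrary: u)
    case 0
    then show ?case by (auto intro: image_eqI[of _ _ u])
  next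
    case (Suc t)
    then obtain w where w: "w \<in> offsets (N + t) \<inter> supp l (N + t)" "u = qmul l 1 w"
      using onto[of "N + t"] by auto
    obtain w' where "w = qmul l t w'"
      using Suc.IH[OF w(1)] by blast
    then have "u = qmul l (Suc t) w'"
      using w(2) qmul_qmul[of 1 t w'] by simp
    then show ?case by blast
  qed
  have "qmod l t u = 0" if u: "u \<in> offsets (N + t)" for t u
  proof -
    have "qmod l (N + t) u = u + qmul l (N + t) (- qdiv l (N + t) u)"
      using qmul_qdiv_qmod[of "N + t" u] qmul_add[of "N + t" "qdiv l (N + t) u" "- qdiv l (N + t) u"]
      by (simp add: algebra_simps eq_neg_iff_add_eq_0[symmetric] del: qmul_qdiv_qmod)
    then have "qmod l (N + t) u \<in> offsets (N + t) \<inter> supp l (N + t)"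
      using offsets_add_qmul[OF u] qmod_in_supp by (metis IntI)
    then obtain w where "qmod l (N + t) u = qmul l t w"
      using div by blast
    then have "qmod l t u = qmod l t (qmul l t w)"
      using qmod_qmod[of t "N + t" u] by simp
    then show ?thesis
      using qmod_qmul_add[of 0 t w] by simp
  qed
  then show ?thesis by blast
qed

lemma offset_trivial:
  assumes "u \<in> offsets n"
  shows "qmod l n u = 0"
proof -
  obtain N where N: "\<And>t v. v \<in> offsets (N + t) \<Longrightarrow> qmod l t v = 0"
    using offsets_divisible by blast
  obtain j where "u + qmul l n j \<in> offsets (n + N)"
    using offsets_refine[OF assms] by blast
  then have "qmod l n (u + qmul l n j) = 0"
    using N[of "u + qmul l n j" n] by (simp add: add.commute)
  then show ?thesis
    by (simp add: qmod_shift)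
qed

theorem recognisable:
  assumes "y \<in> X" "y' \<in> X" "j \<in> supp l k" "j' \<in> supp l k"
    and eq: "shift j (inflate k y) = shift j' (inflate k y')"
  shows "j = j'" "y = y'"
proof -
  have "inflate k y = shift (j' - j) (inflate k y')"
    using eq unfolding shift_swap shift_shift by simp
  then have "j' - j \<in> offsets k"
    using assms by (auto simp: offsets_def)
  then have "qmod l k (j' - j) = 0"
    by (rule offset_trivial)
  then have "j' - j = qmul l k (qdiv l k (j' - j))"
    using qmul_qdiv_qmod[of k "j' - j"] by simp
  then have "j' = j + qmul l k (qdiv l k (j' - j))"
    by (simp add: algebra_simps)
  then have "qmod l k j' = qmod l k j"
    by (metis qmod_shift)
  then show "j = j'"
    using assms by (simp add: qmod_eq_self)
  then show "y = y'"
    using eq inj_inflate[of k] unfolding shift_swap shift_shift by (simp add: inj_eq)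
qed

end

section \<open>The odometer\<close>

context block_substitution
begin

lemma qmod_qmod_add: "qmod l k (s + qmod l k t) = qmod l k (s + t)"
  by (simp add: vec_eq_iff qmod_def mod_add_right_eq)

lemma qmod_add_qmod: "qmod l k (qmod l k s + t) = qmod l k (s + t)"
  using qmod_qmod_add[of k t s] by (simp add: add.commute)

lemma odometer_in_supp: "z \<in> odometer l \<Longrightarrow> z k \<in> supp l k"
  by (simp add: odometer_def)

lemma odometer_coherent:
  assumes "z \<in> odometer l" "j \<le> k"
  shows "qmod l j (z k) = z j"
  using assms(2)
proof (induction k rule: dec_induct)
  case base
  then show ?case
    using odometer_in_supp[OF assms(1)] by (rule qmod_eq_self)
next
  case (step k)
  have "qmod l j (z (Suc k)) = qmod l j (qmod l k (z (Suc k)))"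
    using step by (simp add: qmod_qmod)
  then show ?case
    using step assms(1) by (simp add: odometer_def)
qed

lemma odo_add_int: "odo_add l z (odo_of_int l N) k = qmod l k (z k + N)"
  by (simp add: odo_add_def odo_of_int_def qmod_qmod_add)

lemma odo_add_int_in_odometer:
  assumes "z \<in> odometer l"
  shows "odo_add l z (odo_of_int l N) \<in> odometer l"
proof -
  have "qmod l k (qmod l (Suc k) (z (Suc k) + N)) = qmod l k (z k + N)" for k
    using odometer_coherent[OF assms, of k "Suc k"] qmod_add_qmod[of k "z (Suc k)" N]
    by (simp add: qmod_qmod)
  then show ?thesis
    by (simp add: odometer_def odo_add_int)
qed

lemma odo_add_add:
  "odo_add l (odo_add l z (odo_of_int l N)) (odo_of_int l M) = odo_add l z (odo_of_int l (N + M))"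
  by (rule ext) (simp add: odo_add_int qmod_add_qmod add.assoc)

lemma odo_add_zero:
  assumes "z \<in> odometer l"
  shows "odo_add l z (odo_of_int l 0) = z"
  using odometer_in_supp[OF assms] by (intro ext) (simp add: odo_add_int qmod_eq_self)

lemma odometer_eqI:
  assumes "z \<in> odometer l" "w \<in> odometer l" "\<And>k. k \<ge> K \<Longrightarrow> z k = w k"
  shows "z = w"
proof
  fix k
  show "z k = w k"
    using odometer_coherent[OF assms(1), of k "max k K"] odometer_coherent[OF assms(2), of k "max k K"]
      assms(3)[of "max k K"] by simp
qed

lemma odo_of_digits_Suc: "odo_of_digits l n (Suc k) = qmul l k (n k) + odo_of_digits l n k"
  by (simp add: odo_of_digits_def add.commute)

lemma odo_of_digits_in_odometer:
  assumes "\<And>k. n k \<in> supp l 1"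
  shows "odo_of_digits l n \<in> odometer l"
proof -
  have supp: "odo_of_digits l n k \<in> supp l k" for k
  proof (induction k)
    case 0
    then show ?case by (simp add: odo_of_digits_def)
  next
    case (Suc k)
    then show ?case
      using supp_scale[OF assms Suc, of k] by (simp add: odo_of_digits_Suc)
  qed
  then show ?thesis
    by (simp add: odometer_def odo_of_digits_Suc)
qed

lemma odometer_digits:
  assumes "z \<in> odometer l"
  shows "odo_of_digits l (\<lambda>k. qdiv l k (z (Suc k))) = z"
proof
  fix k
  show "odo_of_digits l (\<lambda>k. qdiv l k (z (Suc k))) k = z k"
  proof (induction k)
    case 0
    then show ?case
      using odometer_in_supp[OF assms, of 0] by (simp add: odo_of_digits_def supp_0)
  next
    case (Suc k)
    then show ?case
      using odometer_coherent[OF assms, of k "Suc k"] qmul_qdiv_qmod[of k "z (Suc k)"]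
      by (simp add: odo_of_digits_Suc)
  qed
qed

text \<open>Once the digits agree, the difference of the partial sums no longer changes.\<close>

lemma odo_of_digits_tail:
  assumes n: "\<And>k. n k \<in> supp l 1" and n': "\<And>k. n' k \<in> supp l 1"
    and tail: "\<And>k. k \<ge> K \<Longrightarrow> n' k = n k"
  shows "\<exists>N. odo_add l (odo_of_digits l n) (odo_of_int l N) = odo_of_digits l n'"
proof -
  define N where "N = odo_of_digits l n' K - odo_of_digits l n K"
  have eq: "odo_of_digits l n k + N = odo_of_digits l n' k" if "k \<ge> K" for k
    using that
  proof (induction k rule: dec_induct)
    case base
    then show ?case by (simp add: N_def)
  next
    case (step k)
    then show ?case
      by (simp add: odo_of_digits_Suc tail add.assoc)
  qed
  have "odo_add l (odo_of_digits l n) (odo_of_int l N) = odo_of_digits l n'"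
  proof (rule odometer_eqI)
    show "odo_add l (odo_of_digits l n) (odo_of_int l N) k = odo_of_digits l n' k" if "k \<ge> K" for k
      using odometer_in_supp[OF odo_of_digits_in_odometer[OF n']]
      by (simp add: odo_add_int eq[OF that] qmod_eq_self)
  qed (intro odo_add_int_in_odometer odo_of_digits_in_odometer n n')+
  then show ?thesis by blast
qed

end

section \<open>Fibres\<close>

context aperiodic_substitution
begin

lemma in_fibre_iff:
  assumes z: "z \<in> odometer l"
  shows "x \<in> fibre l \<theta> z \<longleftrightarrow> x \<in> X \<and> (\<forall>k. \<exists>y\<in>X. x = shift (z k) (inflate k y))"
proof -
  have "pi_tile l \<theta> x k = z k \<longleftrightarrow> (\<exists>y\<in>X. x = shift (z k) (inflate k y))" if x: "x \<in> X" for k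
  proof -
    obtain j y where j: "j \<in> supp l k" "y \<in> X" "x = shift j (inflate k y)"
      using desubstitute[OF x, of k] by blast
    have unique: "i = j" if "i \<in> supp l k" "\<exists>y\<in>X. x = shift i (inflate k y)" for i
      using that j recognisable(1) by metis
    have "pi_tile l \<theta> x k = j"
      unfolding pi_tile_def by (rule the_equality) (use j unique in auto)
    then show ?thesis
      using j unique odometer_in_supp[OF z, of k] by metis
  qed
  then show ?thesis
    by (auto simp: fibre_def fun_eq_iff)
qed

lemma shift_in_fibre:
  assumes z: "z \<in> odometer l" and x: "x \<in> fibre l \<theta> z"
  shows "shift N x \<in> fibre l \<theta> (odo_add l z (odo_of_int l N))"
proof -
  have "\<exists>y\<in>X. shift N x = shift (qmod l k (z k + N)) (inflate k y)" for k
  proof -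
    obtain y where y: "y \<in> X" "x = shift (z k) (inflate k y)"
      using x in_fibre_iff[OF z] by blast
    have "shift N x = shift (qmul l k (qdiv l k (z k + N)) + qmod l k (z k + N)) (inflate k y)"
      unfolding y(2) shift_shift qmul_qdiv_qmod by (simp add: add.commute)
    then have "shift N x = shift (qmod l k (z k + N)) (inflate k (shift (qdiv l k (z k + N)) y))"
      by (simp add: inflate_shift shift_shift add.commute del: qmul_qdiv_qmod)
    then show ?thesis
      using shift_in_subshift[OF y(1)] by blast
  qed
  then show ?thesis
    using x z by (simp add: in_fibre_iff odo_add_int_in_odometer shift_in_subshift odo_add_int)
qed

lemma irregular_fibre_shift:
  assumes z: "z \<in> odometer l"
  shows "irregular_fibre l \<theta> (odo_add l z (odo_of_int l N)) \<longleftrightarrow> irregular_fibre l \<theta> z"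
proof -
  let ?w = "odo_add l z (odo_of_int l N)"
  have "fibre l \<theta> ?w = shift N ` fibre l \<theta> z"
  proof
    show "shift N ` fibre l \<theta> z \<subseteq> fibre l \<theta> ?w"
      using shift_in_fibre[OF z] by blast
    show "fibre l \<theta> ?w \<subseteq> shift N ` fibre l \<theta> z"
    proof
      fix x assume "x \<in> fibre l \<theta> ?w"
      then have "shift (- N) x \<in> fibre l \<theta> z"
        using shift_in_fibre[OF odo_add_int_in_odometer[OF z], of x N "- N"]
        by (simp add: odo_add_add odo_add_zero[OF z])
      moreover have "x = shift N (shift (- N) x)"
        by (simp add: shift_shift)
      ultimately show "x \<in> shift N ` fibre l \<theta> z" by blast
    qed
  qed
  moreover have "inj_on (shift N) (fibre l \<theta> z)"
    by (rule inj_on_inverseI[of _ "shift (- N)"]) (simp add: shift_shift)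
  ultimately show ?thesis
    by (simp add: irregular_fibre_def card_image finite_image_iff)
qed

end

section \<open>Corner patterns\<close>

context block_substitution
begin

definition corner_pattern :: "'d set \<Rightarrow> (int ^ 'd \<Rightarrow> 'a) \<Rightarrow> (int ^ 'd \<rightharpoonup> 'a)" where
  "corner_pattern J x = (Some \<circ> x) |` corner J"

lemma corner_pattern_eq_iff: "corner_pattern J x = corner_pattern J y \<longleftrightarrow> (\<forall>b\<in>corner J. x b = y b)"
  by (auto simp: corner_pattern_def restrict_map_def fun_eq_iff)

lemma zero_in_corner [simp]: "0 \<in> corner J"
  by (simp add: corner_def)

lemma finite_corner [simp]: "finite (corner J :: (int ^ 'd) set)"
proof (rule finite_subset)
  show "corner J \<subseteq> cube 1"
  proof
    fix b :: "int ^ 'd" assume b: "b \<in> corner J"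
    have "- 1 \<le> b $ i \<and> b $ i \<le> 1" for i
      using b by (cases "i \<in> J") (auto simp: corner_def dest!: spec[of _ i])
    then show "b \<in> cube 1"
      by (simp add: cube_def)
  qed
qed simp

lemma qdiv_corner:
  assumes "b \<in> corner J" "w \<in> supp l k" "\<And>i. i \<in> J \<Longrightarrow> w $ i = 0"
  shows "qdiv l k (b + w) = b"
proof -
  have "(b $ i + w $ i) div l $ i ^ k = b $ i" for i
  proof (cases "i \<in> J")
    case True
    then have "b $ i = -1 \<or> b $ i = 0" "w $ i = 0"
      using assms by (auto simp: corner_def split: if_splits dest!: spec[of _ i])
    moreover have "- 1 div l $ i ^ k = - 1"
      using side_pow_pos[of i k] by (simp only: div_eq_minus1)
    ultimately show ?thesis by auto
  next
    case False
    then have "b $ i = 0" "0 \<le> w $ i" "w $ i < l $ i ^ k"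
      using assms by (auto simp: corner_def supp_def split: if_splits dest!: spec[of _ i])
    then show ?thesis
      by (simp add: div_pos_pos_trivial)
  qed
  then show ?thesis
    by (simp add: vec_eq_iff qdiv_def)
qed

lemma corner_pattern_inflate_cong:
  assumes "corner_pattern J x = corner_pattern J y" "w \<in> supp l k" "\<And>i. i \<in> J \<Longrightarrow> w $ i = 0"
  shows "corner_pattern J (shift w (inflate k x)) = corner_pattern J (shift w (inflate k y))"
  using assms by (auto simp: corner_pattern_eq_iff shift_def inflate_eq qdiv_corner)

text \<open>This translates the derived substitution into a statement about configurations: edges of the
  graph relate corners of configurations to those of their desubstitutions.\<close>

lemma derived_column_corner_pattern:
  assumes "n \<in> labels_at l J"
  shows "derived_column l \<theta> J n (corner_pattern J x) = corner_pattern J (shift n (inflate 1 x))"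
proof
  fix b
  have "qdiv l (Suc 0) (b + n) = b" if "b \<in> corner J"
    using qdiv_corner[of b J n 1] that assms by (auto simp: labels_at_def)
  then show "derived_column l \<theta> J n (corner_pattern J x) b = corner_pattern J (shift n (inflate 1 x)) b"
    by (simp add: corner_pattern_def derived_column_def restrict_map_def subst_pat_def shift_def subst_conf_def)
qed

lemma labels_in_supp: "n \<in> labels_at l J \<Longrightarrow> n \<in> supp l 1"
  by (simp add: labels_at_def)

lemma labels_zero: "n \<in> labels_at l J \<Longrightarrow> i \<in> J \<Longrightarrow> n $ i = 0"
  by (simp add: labels_at_def)

lemma odo_of_digits_zero:
  assumes "\<And>k. n k \<in> labels_at l J" "i \<in> J"
  shows "odo_of_digits l n k $ i = 0"
  using labels_zero[OF assms(1) assms(2)] by (simp add: odo_of_digits_def qmul_def)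

end

context aperiodic_substitution
begin

lemma alphabet_at_eq: "alphabet_at l \<theta> J = corner_pattern J ` X"
  by (simp add: alphabet_at_def legal_patches corner_pattern_def[abs_def])

lemma finite_alphabet_at: "finite (alphabet_at l \<theta> J)"
proof (rule finite_subset)
  show "alphabet_at l \<theta> J \<subseteq> {m. dom m = corner J \<and> ran m \<subseteq> UNIV}"
    by (auto simp: alphabet_at_def lang_def)
  show "finite {m :: int ^ 'd \<rightharpoonup> 'a. dom m = corner J \<and> ran m \<subseteq> UNIV}"
    by (rule finite_set_of_finite_maps) simp_all
qed

lemma derived_column_in_alphabet:
  assumes "n \<in> labels_at l J"
  shows "derived_column l \<theta> J n ` alphabet_at l \<theta> J \<subseteq> alphabet_at l \<theta> J"
  using derived_column_corner_pattern[OF assms] shift_in_subshift[OF inflate_in_subshift, of _ n 1]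
  by (auto simp: alphabet_at_eq)

lemma graph_verts_subset: "U \<in> graph_verts l \<theta> J \<Longrightarrow> U \<subseteq> alphabet_at l \<theta> J"
proof (induction rule: graph_verts.induct)
  case (step U n)
  then show ?case
    using derived_column_in_alphabet[of n J] by blast
qed simp

lemma finite_graph_vert: "U \<in> graph_verts l \<theta> J \<Longrightarrow> finite U"
  using graph_verts_subset finite_alphabet_at finite_subset by blast

lemma finite_graph_verts: "finite (graph_verts l \<theta> J)"
  by (rule finite_subset[of _ "Pow (alphabet_at l \<theta> J)"])
     (use graph_verts_subset finite_alphabet_at in auto)

text \<open>Each cell of a corner pattern evolves under a column of \<open>\<theta>\<close> independently of the other cells,
  and every letter occurs at \<open>0\<close> in some pattern. This is why no vertex has fewer elements than the
  column number, so that pruning leaves exactly the vertices with more.\<close>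

lemma graph_vert_column:
  assumes "U \<in> graph_verts l \<theta> J"
  shows "\<exists>k. \<exists>j\<in>supp l k. (\<lambda>P. the (P 0)) ` U = range (\<lambda>a. subst_pow l \<theta> k a j)"
  using assms
proof (induction rule: graph_verts.induct)
  case start
  have "a \<in> (\<lambda>P. the (P 0)) ` alphabet_at l \<theta> J" for a
  proof -
    obtain k where k: "\<And>s a b. k \<le> s \<Longrightarrow> \<exists>p\<in>supp l s. subst_pow l \<theta> s a p = b"
      using letter_occurs by metis
    obtain x where x: "x \<in> X" using nonempty by blast
    obtain p where p: "p \<in> supp l k" "subst_pow l \<theta> k (x 0) p = a" using k by blast
    have "shift p (inflate k x) \<in> X"
      by (intro shift_in_subshift inflate_in_subshift x)
    moreover have "shift p (inflate k x) 0 = a"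
      using inflate_at[OF p(1), of x 0] p(2) by (simp add: shift_def)
    ultimately show ?thesis
      by (force simp: alphabet_at_eq image_iff corner_pattern_def)
  qed
  then have "(\<lambda>P. the (P 0)) ` alphabet_at l \<theta> J = UNIV" by blast
  then show ?case
    by (intro exI[of _ 0] bexI[of _ 0]) auto
next
  case (step U n)
  then obtain k j where j: "j \<in> supp l k"
      "(\<lambda>P. the (P 0)) ` U = range (\<lambda>a. subst_pow l \<theta> k a j)"
    by blast
  have n: "n \<in> supp l 1"
    by (rule labels_in_supp[OF step(2)])
  have "the (derived_column l \<theta> J n P 0) = \<theta> (the (P 0)) n" if "P \<in> U" for P
  proof -
    obtain x where x: "P = corner_pattern J x"
      using graph_verts_subset[OF step(1)] \<open>P \<in> U\<close> by (auto simp: alphabet_at_eq)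
    show ?thesis
      unfolding x derived_column_corner_pattern[OF step(2)]
      using qdiv_eq_0[OF n] qmod_eq_self[OF n] by (simp add: corner_pattern_def shift_def subst_conf_def)
  qed
  then have "(\<lambda>P. the (P 0)) ` derived_column l \<theta> J n ` U = (\<lambda>b. \<theta> b n) ` (\<lambda>P. the (P 0)) ` U"
    by (simp add: image_image)
  also have "\<dots> = range (\<lambda>a. subst_pow l \<theta> (Suc k) a (qmul l 1 j + n))"
    using subst_pow_add[OF n, of k _ j] qmod_eq_self[OF n] by (simp add: j(2) image_image)
  finally show ?case
    using supp_scale[OF j(1) n] by (intro exI[of _ "Suc k"] bexI[of _ "qmul l 1 j + n"]) simp_all
qed

lemma column_number_le:
  assumes "j \<in> supp l k"
  shows "column_number l \<theta> \<le> card (range (\<lambda>a. subst_pow l \<theta> k a j))"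
proof (cases "k \<ge> 1")
  case True
  then show ?thesis
    unfolding column_number_def using assms by (intro Least_le) blast
next
  case False
  have "column_number l \<theta> \<le> card (range (\<lambda>a. subst_pow l \<theta> 1 a 0))"
    unfolding column_number_def by (intro Least_le exI[of _ 1] conjI bexI[of _ 0]) simp_all
  also have "\<dots> \<le> card (UNIV :: 'a set)"
    by (rule card_mono) simp_all
  finally show ?thesis
    using False by (cases k) simp_all
qed

lemma card_graph_vert:
  assumes "U \<in> graph_verts l \<theta> J"
  shows "column_number l \<theta> \<le> card U"
proof -
  obtain k j where "j \<in> supp l k" "(\<lambda>P. the (P 0)) ` U = range (\<lambda>a. subst_pow l \<theta> k a j)"
    using graph_vert_column[OF assms] by blast
  then show ?thesis
    using column_number_le card_image_le[OF finite_graph_vert[OF assms], of "\<lambda>P. the (P 0)"]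
    by (metis order.trans)
qed

lemma pruned_op_edges_iff:
  "(V, n, U) \<in> pruned_op_edges l \<theta> J \<longleftrightarrow> U \<in> graph_verts l \<theta> J \<and> n \<in> labels_at l J \<and>
     V = derived_column l \<theta> J n ` U \<and> card V > column_number l \<theta> \<and> card U > column_number l \<theta>"
  using card_graph_vert[of U J] card_graph_vert[OF graph_verts.step, of U J n]
  by (auto simp: pruned_op_edges_def op_edges_def graph_edges_def)

section \<open>Paths and fibres\<close>

text \<open>Following the path upwards, \<open>P\<close> is the corner of \<open>k\<close>-fold inflated configurations for every
  \<open>k\<close>, each placed at the offset that the label sequence prescribes. A cluster point of them keeps
  the corner and can be desubstituted at all levels with these offsets.\<close>

lemma corner_lifts_to_fibre:
  assumes n: "\<And>k. n k \<in> labels_at l J"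
    and V: "\<And>k. V k \<subseteq> alphabet_at l \<theta> J"
    and step: "\<And>k. V k = derived_column l \<theta> J (n k) ` V (Suc k)"
    and P: "P \<in> V 0"
  shows "\<exists>x\<in>fibre l \<theta> (odo_of_digits l n). corner_pattern J x = P"
proof -
  define w where "w = odo_of_digits l n"
  have w: "w \<in> odometer l"
    unfolding w_def by (rule odo_of_digits_in_odometer) (rule labels_in_supp[OF n])
  have w_Suc: "w (Suc k) = qmul l k (n k) + w k" for k
    by (simp add: w_def odo_of_digits_Suc)
  have w0: "w k $ i = 0" if "i \<in> J" for i k
    unfolding w_def by (rule odo_of_digits_zero[OF n that])
  have "\<exists>y\<in>X. corner_pattern J y \<in> V k \<and> corner_pattern J (shift (w k) (inflate k y)) = P" for k
  proof (induction k)
    case 0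
    obtain y where "y \<in> X" "P = corner_pattern J y"
      using P V[of 0] by (auto simp: alphabet_at_eq)
    then show ?case
      using P odometer_in_supp[OF w, of 0] by (intro bexI[of _ y]) (auto simp: supp_0)
  next
    case (Suc k)
    then obtain y where y: "y \<in> X" "corner_pattern J y \<in> V k" "corner_pattern J (shift (w k) (inflate k y)) = P"
      by blast
    then obtain P' where P': "P' \<in> V (Suc k)" "corner_pattern J y = derived_column l \<theta> J (n k) P'"
      using step[of k] by blast
    then obtain u where u: "u \<in> X" "P' = corner_pattern J u"
      using V[of "Suc k"] by (auto simp: alphabet_at_eq)
    have "corner_pattern J y = corner_pattern J (shift (n k) (inflate 1 u))"
      using P'(2) u(2) derived_column_corner_pattern[OF n] by simp
    then have "corner_pattern J (shift (w k) (inflate k (shift (n k) (inflate 1 u)))) = P"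
      using corner_pattern_inflate_cong[OF _ odometer_in_supp[OF w] w0] y(3) by metis
    moreover have "shift (w k) (inflate k (shift (n k) (inflate 1 u))) =
        shift (w (Suc k)) (inflate (Suc k) u)"
      using inflate_add[of k 1 u] by (simp add: inflate_shift shift_shift w_Suc add.commute)
    ultimately show ?case
      using u P'(1) by (intro bexI[of _ u]) simp_all
  qed
  then obtain y where y: "\<And>k. y k \<in> X" "\<And>k. corner_pattern J (shift (w k) (inflate k (y k))) = P"
    by metis
  define x where "x k = shift (w k) (inflate k (y k))" for k
  have x_desubst: "x k \<in> (\<lambda>u. shift (w m) (inflate m u)) ` X" if "m \<le> k" for m k
  proof -
    have "w k = w m + qmul l m (qdiv l m (w k))"
      using odometer_coherent[OF w that] qmul_qdiv_qmod[of m "w k"] by (simp add: add.commute)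
    then have "x k = shift (w m + qmul l m (qdiv l m (w k))) (inflate (m + (k - m)) (y k))"
      using that by (simp add: x_def)
    then have "x k = shift (w m) (inflate m (shift (qdiv l m (w k)) (inflate (k - m) (y k))))"
      by (simp only: inflate_add inflate_shift shift_shift)
    then show ?thesis
      using shift_in_subshift[OF inflate_in_subshift[OF y(1)]] by blast
  qed
  obtain u where u: "\<And>B N. finite B \<Longrightarrow> \<exists>k\<ge>N. \<forall>t\<in>B. x k t = u t"
    using cluster_point[of x] by metis
  have desubst: "u \<in> (\<lambda>v. shift (w m) (inflate m v)) ` X" for m
  proof (rule limit_closedD[OF limit_closed_inflate[OF limit_closed_subshift]])
    fix B :: "(int ^ 'd) set" assume "finite B"
    then show "\<exists>v\<in>(\<lambda>v. shift (w m) (inflate m v)) ` X. \<forall>t\<in>B. v t = u t"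
      using u[of B m] x_desubst[of m] by blast
  qed
  have "u \<in> X"
    using desubst[of 0] shift_in_subshift by auto
  then have "u \<in> fibre l \<theta> w"
    using desubst in_fibre_iff[OF w] by blast
  moreover have "corner_pattern J u = P"
  proof -
    obtain k where k: "\<forall>t\<in>corner J. x k t = u t"
      using u[OF finite_corner, of 0 J] by blast
    then have "corner_pattern J u = corner_pattern J (x k)"
      by (simp add: corner_pattern_eq_iff)
    then show ?thesis
      using y(2)[of k] by (simp add: x_def)
  qed
  ultimately show ?thesis
    unfolding w_def by blast
qed

text \<open>The first vertex of a path has more than \<open>c\<close> elements, and distinct patterns are corners of
  distinct points.\<close>

lemma label_shift_irregular:
  assumes "n \<in> label_shift l \<theta> J"
  shows "irregular_fibre l \<theta> (odo_of_digits l n)"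
proof -
  obtain V where V: "\<And>k. (V k, n k, V (Suc k)) \<in> pruned_op_edges l \<theta> J"
    using assms by (auto simp: label_shift_def)
  note V = V[unfolded pruned_op_edges_iff]
  have n: "n k \<in> labels_at l J" for k
    using V by blast
  have V_verts: "V k \<in> graph_verts l \<theta> J" for k
    using V[of k] by (auto intro: graph_verts.step)
  let ?F = "fibre l \<theta> (odo_of_digits l n)"
  have "V 0 \<subseteq> corner_pattern J ` ?F"
  proof
    fix P assume "P \<in> V 0"
    then have "\<exists>x\<in>?F. corner_pattern J x = P"
      by (rule corner_lifts_to_fibre[where V = V, rotated -1])
         (use V n V_verts graph_verts_subset in blast)+
    then show "P \<in> corner_pattern J ` ?F" by blast
  qed
  then have "card (V 0) \<le> card ?F" if "finite ?F"
    using surj_card_le[OF that] by blast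
  then show ?thesis
    using V[of 0] by (auto simp: irregular_fibre_def)
qed

text \<open>The distances from the origin to the two ends of its supertile of level \<open>k\<close> are non-decreasing
  in \<open>k\<close>. If one of them were bounded it would become constant, and then the coordinate of \<open>w\<close> would
  be an integer, non-negative for the lower end and negative for the upper one.\<close>

lemma supertiles_cover_coordinate:
  assumes w: "w \<in> odometer l"
    and nonint: "\<not> (\<exists>m. \<forall>k. w k $ i = m mod l $ i ^ k)"
  shows "\<exists>K. \<forall>k\<ge>K. 0 \<le> t + w k $ i \<and> t + w k $ i < l $ i ^ k"
proof -
  have coherent: "w k $ i mod l $ i ^ j = w j $ i" if "j \<le> k" for j k
    using odometer_coherent[OF w that] by (auto simp: qmod_def vec_eq_iff)
  have range: "0 \<le> w k $ i" "w k $ i < l $ i ^ k" for k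
    using odometer_in_supp[OF w, of k] by (auto simp: supp_def)
  have step: "\<exists>d. 0 \<le> d \<and> d < l $ i \<and> w (Suc k) $ i = l $ i ^ k * d + w k $ i" for k
  proof -
    have "w (Suc k) $ i = l $ i ^ k * (w (Suc k) $ i div l $ i ^ k) + w k $ i"
      using coherent[of k "Suc k"] mult_div_mod_eq[of "l $ i ^ k" "w (Suc k) $ i"] by simp
    moreover have "qdiv l k (w (Suc k)) \<in> supp l 1"
      using qdiv_in_supp[of "w (Suc k)" k 1] odometer_in_supp[OF w, of "Suc k"] by simp
    then have "0 \<le> w (Suc k) $ i div l $ i ^ k" "w (Suc k) $ i div l $ i ^ k < l $ i"
      by (auto simp: supp_def qdiv_def)
    ultimately show ?thesis by blast
  qed
  have up: "w k $ i \<le> w (Suc k) $ i" for k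
  proof -
    obtain d where "0 \<le> d" "w (Suc k) $ i = l $ i ^ k * d + w k $ i"
      using step[of k] by blast
    then show ?thesis by simp
  qed
  have up': "l $ i ^ k - w k $ i \<le> l $ i ^ Suc k - w (Suc k) $ i" for k
  proof -
    obtain d where d: "d < l $ i" "w (Suc k) $ i = l $ i ^ k * d + w k $ i"
      using step[of k] by blast
    then have "l $ i ^ k * (d + 1) \<le> l $ i ^ k * l $ i"
      by (intro mult_left_mono) auto
    then show ?thesis
      using d(2) by (simp add: algebra_simps)
  qed
  have unbounded: "\<exists>K. \<forall>k\<ge>K. c \<le> g k"
    if g: "\<And>k. g k \<le> g (Suc k)" and ne: "\<And>m. \<exists>k. \<forall>j\<ge>k. g j \<noteq> m" for g :: "nat \<Rightarrow> int" and c
  proof -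
    have mono: "g j \<le> g k" if "j \<le> k" for j k
      using lift_Suc_mono_le[of g, OF g that] .
    have "\<exists>K. g 0 + int c' \<le> g K" for c'
    proof (induction c')
      case 0
      show ?case by auto
    next
      case (Suc c')
      then obtain K where K: "g 0 + int c' \<le> g K" by blast
      obtain k where "\<forall>j\<ge>k. g j \<noteq> g K" using ne by blast
      then have "g (max k K) \<noteq> g K" by simp
      then show ?case
        using mono[of K "max k K"] K by (intro exI[of _ "max k K"]) linarith
    qed
    from this[of "nat (c - g 0)"] obtain K where "g 0 + int (nat (c - g 0)) \<le> g K" by blast
    then have "c \<le> g K" by linarith
    then show ?thesis
      using mono order_trans by blast
  qed
  have "\<exists>k. \<forall>j\<ge>k. w j $ i \<noteq> m" for m
  proof (rule ccontr)
    \<comment> \<open>an integer that equals \<open>w j $ i\<close> for infinitely many \<open>j\<close> represents the coordinate \<open>i\<close> of \<open>w\<close>\<close>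
    assume "\<not> ?thesis"
    then have "\<forall>k. \<exists>j\<ge>k. w j $ i = m" by blast
    then have "\<forall>k. w k $ i = m mod l $ i ^ k"
      using coherent by metis
    then show False
      using nonint by blast
  qed
  then obtain K1 where K1: "\<And>k. k \<ge> K1 \<Longrightarrow> - t \<le> w k $ i"
    using unbounded[of "\<lambda>k. w k $ i" "- t", OF up] by blast
  have "\<exists>k. \<forall>j\<ge>k. l $ i ^ j - w j $ i \<noteq> m" for m
  proof (rule ccontr)
    assume "\<not> ?thesis"
    then have inf: "\<forall>k. \<exists>j\<ge>k. l $ i ^ j - w j $ i = m" by blast
    have "w k $ i = (- m) mod l $ i ^ k" for k
    proof -
      obtain j where j: "j \<ge> k" "l $ i ^ j - w j $ i = m" using inf by blast
      then have "- m = w j $ i - l $ i ^ j" by simp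
      moreover have "(w j $ i - l $ i ^ j) mod l $ i ^ k = w j $ i mod l $ i ^ k"
        using le_imp_power_dvd[OF j(1), of "l $ i"] by (simp add: mod_diff_eq[symmetric] dvd_imp_mod_0)
      ultimately show ?thesis
        using coherent[OF j(1)] by simp
    qed
    then show False
      using nonint by blast
  qed
  then obtain K2 where K2: "\<And>k. k \<ge> K2 \<Longrightarrow> t + 1 \<le> l $ i ^ k - w k $ i"
    using unbounded[of "\<lambda>k. l $ i ^ k - w k $ i" "t + 1", OF up'] by blast
  show ?thesis
    using K1 K2 by (intro exI[of _ "max K1 K2"]) (smt (verit) max.bounded_iff)
qed

text \<open>For a coordinate in \<open>J\<close> the supertiles at \<open>-1\<close> and \<open>0\<close> have a fixed common boundary and
  together grow in both directions.\<close>

lemma corner_supertiles_cover: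
  assumes w: "w \<in> odometer l"
    and zero: "\<And>i k. i \<in> J \<Longrightarrow> w k $ i = 0"
    and nonint: "\<And>i. i \<notin> J \<Longrightarrow> \<not> (\<exists>m. \<forall>k. w k $ i = m mod l $ i ^ k)"
  shows "\<exists>K. \<forall>k\<ge>K. qdiv l k (t + w k) \<in> corner J"
proof -
  have "\<exists>K. \<forall>k\<ge>K. (t $ i + w k $ i) div l $ i ^ k \<in> (if i \<in> J then {-1, 0} else {0})" for i
  proof (cases "i \<in> J")
    case True
    have "t $ i div l $ i ^ k \<in> {-1, 0}" if "k \<ge> nat \<bar>t $ i\<bar>" for k
    proof -
      have "int k < 2 ^ k"
        by (metis of_nat_less_two_power)
      also have "(2 :: int) ^ k \<le> l $ i ^ k"
        using expansive by (intro power_mono) auto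
      finally have "- (l $ i ^ k) \<le> t $ i" "t $ i < l $ i ^ k"
        using that by linarith+
      then show ?thesis
        by (cases "t $ i \<ge> 0")
           (auto simp: div_pos_pos_trivial intro!: int_div_pos_eq[where q = "- 1" and r = "t $ i + l $ i ^ k"])
    qed
    then show ?thesis
      using True zero by (intro exI[of _ "nat \<bar>t $ i\<bar>"]) simp
  next
    case False
    then obtain K where "\<forall>k\<ge>K. 0 \<le> t $ i + w k $ i \<and> t $ i + w k $ i < l $ i ^ k"
      using supertiles_cover_coordinate[OF w nonint, of i "t $ i"] by blast
    then show ?thesis
      using False by (intro exI[of _ K]) (simp add: div_pos_pos_trivial)
  qed
  then have "\<forall>i. \<exists>K. \<forall>k\<ge>K. (t $ i + w k $ i) div l $ i ^ k \<in> (if i \<in> J then {-1, 0} else {0})"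
    by blast
  from choice[OF this] obtain K where K: "\<And>i k. k \<ge> K i \<Longrightarrow>
      (t $ i + w k $ i) div l $ i ^ k \<in> (if i \<in> J then {-1, 0} else {0})"
    by blast
  have K_le: "K i \<le> (\<Sum>i\<in>UNIV. K i)" for i
    using member_le_sum[of i UNIV K] by simp
  then have "qdiv l k (t + w k) \<in> corner J" if "k \<ge> (\<Sum>i\<in>UNIV. K i)" for k
  proof -
    have "(t $ i + w k $ i) div l $ i ^ k \<in> (if i \<in> J then {-1, 0} else {0})" for i
      by (rule K[OF order_trans[OF K_le that]])
    then show ?thesis
      by (simp add: corner_def qdiv_def)
  qed
  then show ?thesis by blast
qed

text \<open>A position where two points of the fibre differ is covered by the corner supertiles of every
  sufficiently high level, so the corner patterns of the desubstitutions differ too.\<close>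

lemma fibre_points_separate:
  assumes w: "w \<in> odometer l"
    and zero: "\<And>i k. i \<in> J \<Longrightarrow> w k $ i = 0"
    and nonint: "\<And>i. i \<notin> J \<Longrightarrow> \<not> (\<exists>m. \<forall>k. w k $ i = m mod l $ i ^ k)"
    and T: "finite T"
    and Y: "\<And>k x. x \<in> T \<Longrightarrow> x = shift (w k) (inflate k (Y k x))"
  shows "\<exists>K. \<forall>k\<ge>K. inj_on (\<lambda>x. corner_pattern J (Y k x)) T"
proof -
  have "\<exists>K. \<forall>k\<ge>K. corner_pattern J (Y k x) = corner_pattern J (Y k x') \<longrightarrow> x = x'" if x: "x \<in> T" "x' \<in> T" for x x'
  proof (cases "x = x'")
    case False
    then obtain t where t: "x t \<noteq> x' t" by blast
    obtain K where K: "\<And>k. k \<ge> K \<Longrightarrow> qdiv l k (t + w k) \<in> corner J"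
      using corner_supertiles_cover[OF w zero nonint, where t = t] by blast
    have "corner_pattern J (Y k x) \<noteq> corner_pattern J (Y k x')" if "k \<ge> K" for k
    proof
      assume "corner_pattern J (Y k x) = corner_pattern J (Y k x')"
      then have "Y k x (qdiv l k (t + w k)) = Y k x' (qdiv l k (t + w k))"
        using K[OF that] by (simp add: corner_pattern_eq_iff)
      then have "shift (w k) (inflate k (Y k x)) t = shift (w k) (inflate k (Y k x')) t"
        by (simp add: shift_def inflate_eq)
      then show False
        using Y[OF x(1), of k] Y[OF x(2), of k] t by metis
    qed
    then show ?thesis by blast
  qed auto
  then have "\<forall>p\<in>T \<times> T. \<exists>K. \<forall>k\<ge>K.
      corner_pattern J (Y k (fst p)) = corner_pattern J (Y k (snd p)) \<longrightarrow> fst p = snd p"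
    by force
  then obtain K where K: "\<And>p k. p \<in> T \<times> T \<Longrightarrow> K p \<le> k \<Longrightarrow>
      corner_pattern J (Y k (fst p)) = corner_pattern J (Y k (snd p)) \<longrightarrow> fst p = snd p"
    by metis
  have "inj_on (\<lambda>x. corner_pattern J (Y k x)) T" if "k \<ge> (\<Sum>p\<in>T\<times>T. K p)" for k
  proof (rule inj_onI)
    fix x x' assume x: "x \<in> T" "x' \<in> T" "corner_pattern J (Y k x) = corner_pattern J (Y k x')"
    then have "K (x, x') \<le> k"
      using member_le_sum[of "(x, x')" "T \<times> T" K] T that by simp
    then show "x = x'"
      using K[of "(x, x')" k] x by simp
  qed
  then show ?thesis by blast
qed

text \<open>The patterns of level \<open>k\<close> that come from level \<open>k + m\<close>. These sets shrink as \<open>m\<close> grows; the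
  eventual value for each \<open>k\<close> is again a vertex, and these values form a path.\<close>

primrec images :: "'d set \<Rightarrow> (nat \<Rightarrow> int ^ 'd) \<Rightarrow> nat \<Rightarrow> nat \<Rightarrow> (int ^ 'd \<rightharpoonup> 'a) set" where
  "images J n 0 k = alphabet_at l \<theta> J"
| "images J n (Suc m) k = derived_column l \<theta> J (n k) ` images J n m (Suc k)"

lemma images_in_graph:
  "(\<And>k. n k \<in> labels_at l J) \<Longrightarrow> images J n m k \<in> graph_verts l \<theta> J"
  by (induction m arbitrary: k) (auto intro: graph_verts.intros)

lemma images_Suc_subset:
  assumes "\<And>k. n k \<in> labels_at l J"
  shows "images J n (Suc m) k \<subseteq> images J n m k"
proof (induction m arbitrary: k)
  case 0
  then show ?case
    using derived_column_in_alphabet[OF assms] by simp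
next
  case (Suc m)
  then show ?case
    by (metis image_mono images.simps(2))
qed

lemma image_path:
  assumes n: "\<And>k. n k \<in> labels_at l J"
  obtains E where "\<And>k. E k \<in> graph_verts l \<theta> J"
    "\<And>k. E k = derived_column l \<theta> J (n k) ` E (Suc k)"
    "\<And>k. \<exists>m. E k = images J n m k"
proof -
  have "\<exists>M. \<forall>m\<ge>M. images J n m k = images J n M k" for k
    using images_Suc_subset[OF n] finite_graph_vert[OF images_in_graph[OF n]]
    by (intro decreasing_sets_stabilise) simp_all
  then obtain M where M: "\<And>k m. m \<ge> M k \<Longrightarrow> images J n m k = images J n (M k) k"
    by metis
  define E where "E k = images J n (M k) k" for k
  show thesis
  proof (rule that[of E])
    fix k
    show "E k \<in> graph_verts l \<theta> J"
      by (simp add: E_def images_in_graph[OF n])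
    show "\<exists>m. E k = images J n m k"
      by (auto simp: E_def)
    show "E k = derived_column l \<theta> J (n k) ` E (Suc k)"
      using M[of k "Suc (max (M k) (M (Suc k)))"] M[of "Suc k" "max (M k) (M (Suc k))"]
      by (simp add: E_def)
  qed
qed

text \<open>As the graph is finite, the path runs through some vertex twice after level \<open>K\<close>, and its
  beginning can be replaced by a walk around the resulting cycle of large vertices.\<close>

lemma replace_beginning:
  assumes n: "\<And>k. n k \<in> labels_at l J"
    and E: "\<And>k. E k \<in> graph_verts l \<theta> J"
    and step: "\<And>k. E k = derived_column l \<theta> J (n k) ` E (Suc k)"
    and large: "\<And>k. k \<ge> K \<Longrightarrow> card (E k) > column_number l \<theta>"
  obtains n' k1 where "n' \<in> label_shift l \<theta> J" "\<And>k. n' k \<in> labels_at l J"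
    "\<And>k. k \<ge> k1 \<Longrightarrow> n' k = n k"
proof -
  have "finite (E ` {K..})"
    by (rule finite_subset[OF _ finite_graph_verts[of J]]) (use E in blast)
  then have "\<not> inj_on E {K..}"
    using finite_imageD[of E "{K..}"] infinite_Ici[of K] by blast
  then obtain k1 k2 where k12: "K \<le> k1" "k1 < k2" "E k1 = E k2"
    unfolding inj_on_def by (metis atLeast_iff linorder_neqE_nat)
  \<comment> \<open>the vertices of the cycle; from each of them some edge of the unreversed graph stays in \<open>C\<close>\<close>
  define C where "C = E ` {k1..k2}"
  have "\<exists>d. d \<in> labels_at l J \<and> derived_column l \<theta> J d ` U \<in> C" if U: "U \<in> C" for U
  proof -
    obtain k where k: "k1 < k" "k \<le> k2" "U = E k"
    proof -
      note * = that
      obtain k where k: "k1 \<le> k" "k \<le> k2" "U = E k"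
        using U by (auto simp: C_def)
      show thesis
      proof (cases "k = k1")
        case True
        then show thesis
          using k k12 by (intro *[of k2]) simp_all
      next
        case False
        then show thesis
          using k by (intro *[of k]) simp_all
      qed
    qed
    have "derived_column l \<theta> J (n (k - 1)) ` U = E (k - 1)"
      using step[of "k - 1"] k by simp
    moreover have "E (k - 1) \<in> C"
      using k unfolding C_def by (intro imageI) (simp, linarith)
    ultimately show ?thesis
      using n by metis
  qed
  then obtain h where h: "\<And>U. U \<in> C \<Longrightarrow> h U \<in> labels_at l J"
      "\<And>U. U \<in> C \<Longrightarrow> derived_column l \<theta> J (h U) ` U \<in> C"
    by metis
  \<comment> \<open>the walk against the direction of the path, starting where the old path is kept\<close>
  define W where "W i = ((\<lambda>U. derived_column l \<theta> J (h U) ` U) ^^ i) (E k1)" for i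
  have W_Suc: "W (Suc i) = derived_column l \<theta> J (h (W i)) ` W i" for i
    by (simp add: W_def)
  have W_in: "W i \<in> C" for i
  proof (induction i)
    case 0
    show ?case
      using k12 by (auto simp: W_def C_def)
  next
    case (Suc i)
    then show ?case
      by (simp add: W_Suc h(2))
  qed
  define V where "V k = (if k < k1 then W (k1 - k) else E k)" for k
  define n' where "n' k = (if k < k1 then h (W (k1 - Suc k)) else n k)" for k
  have V_large: "V k \<in> graph_verts l \<theta> J \<and> card (V k) > column_number l \<theta>" for k
    using W_in[of "k1 - k"] E large k12 by (auto simp: V_def C_def)
  have n': "n' k \<in> labels_at l J" for k
    using h(1)[OF W_in] n by (simp add: n'_def)
  have "V k = derived_column l \<theta> J (n' k) ` V (Suc k)" for k
  proof (cases "k < k1")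
    case True
    then have "V (Suc k) = W (k1 - Suc k)"
      by (auto simp: V_def W_def not_less_eq[symmetric] intro!: arg_cong[of _ _ E])
    moreover have "k1 - k = Suc (k1 - Suc k)"
      using True by simp
    ultimately show ?thesis
      using True W_Suc[of "k1 - Suc k"] by (simp add: V_def n'_def)
  next
    case False
    then show ?thesis
      using step[of k] by (simp add: V_def n'_def)
  qed
  then have "(V k, n' k, V (Suc k)) \<in> pruned_op_edges l \<theta> J" for k
    unfolding pruned_op_edges_iff using V_large n' by metis
  then have "n' \<in> label_shift l \<theta> J"
    by (auto simp: label_shift_def)
  then show thesis
    using that[of n' k1] n' by (simp add: n'_def)
qed

text \<open>The points of the fibre put many patterns into the eventual images of all high levels; these
  images are the vertices of a path once its beginning has been replaced.\<close>

lemma irregular_label_shift: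
  assumes w: "w \<in> odometer l"
    and zero: "\<And>i k. i \<in> J \<Longrightarrow> w k $ i = 0"
    and nonint: "\<And>i. i \<notin> J \<Longrightarrow> \<not> (\<exists>m. \<forall>k. w k $ i = m mod l $ i ^ k)"
    and irregular: "irregular_fibre l \<theta> w"
  shows "\<exists>N. odo_add l w (odo_of_int l N) \<in> odo_of_digits l ` label_shift l \<theta> J"
proof -
  define n where "n k = qdiv l k (w (Suc k))" for k
  have digits: "odo_of_digits l n = w"
    unfolding n_def by (rule odometer_digits[OF w])
  have n: "n k \<in> labels_at l J" for k
    using qdiv_in_supp[of "w (Suc k)" k 1] odometer_in_supp[OF w, of "Suc k"] zero
    by (auto simp: labels_at_def n_def qdiv_def)
  obtain T where T: "T \<subseteq> fibre l \<theta> w" "finite T" "card T = Suc (column_number l \<theta>)"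
  proof (cases "finite (fibre l \<theta> w)")
    case True
    then show ?thesis
      using irregular that obtain_subset_with_card_n[of "Suc (column_number l \<theta>)" "fibre l \<theta> w"]
      by (auto simp: irregular_fibre_def Suc_le_eq)
  next
    case False
    then show ?thesis
      using infinite_arbitrarily_large that by blast
  qed
  have "\<forall>k. \<forall>x\<in>T. \<exists>y. y \<in> X \<and> x = shift (w k) (inflate k y)"
    using T(1) in_fibre_iff[OF w] by blast
  then obtain Y where Y: "\<And>k x. x \<in> T \<Longrightarrow> Y k x \<in> X"
      "\<And>k x. x \<in> T \<Longrightarrow> x = shift (w k) (inflate k (Y k x))"
    by metis
  have Y_step: "Y k x = shift (n k) (inflate 1 (Y (Suc k) x))" if "x \<in> T" for k x
  proof (rule recognisable(2)[OF _ _ odometer_in_supp[OF w] odometer_in_supp[OF w]])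
    show "Y k x \<in> X" "shift (n k) (inflate 1 (Y (Suc k) x)) \<in> X"
      using Y(1)[OF that] by (simp_all only: shift_in_subshift inflate_in_subshift)
    have "shift (w k) (inflate k (Y k x)) = shift (w (Suc k)) (inflate (Suc k) (Y (Suc k) x))"
      using Y(2)[OF that, of k] Y(2)[OF that, of "Suc k"] by metis
    also have "w (Suc k) = qmul l k (n k) + w k"
      using odo_of_digits_Suc[of n k] digits by simp
    also have "shift (qmul l k (n k) + w k) (inflate (Suc k) (Y (Suc k) x)) =
        shift (w k) (inflate k (shift (n k) (inflate 1 (Y (Suc k) x))))"
      using inflate_add[of k 1] by (simp add: inflate_shift shift_shift add.commute)
    finally show "shift (w k) (inflate k (Y k x)) =
        shift (w k) (inflate k (shift (n k) (inflate 1 (Y (Suc k) x))))" .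
  qed
  have in_images: "corner_pattern J (Y k x) \<in> images J n m k" if "x \<in> T" for x k m
  proof (induction m arbitrary: k)
    case 0
    then show ?case
      using Y(1)[OF that] by (simp add: alphabet_at_eq)
  next
    case (Suc m)
    have "corner_pattern J (Y k x) = derived_column l \<theta> J (n k) (corner_pattern J (Y (Suc k) x))"
      unfolding derived_column_corner_pattern[OF n] by (subst Y_step[OF that]) (rule refl)
    then show ?case
      using Suc by simp
  qed
  obtain E where E: "\<And>k. E k \<in> graph_verts l \<theta> J"
    "\<And>k. E k = derived_column l \<theta> J (n k) ` E (Suc k)"
    "\<And>k. \<exists>m. E k = images J n m k"
    by (rule image_path[where J = J, OF n]) (rule that)
  obtain K where K: "\<And>k. k \<ge> K \<Longrightarrow> inj_on (\<lambda>x. corner_pattern J (Y k x)) T"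
    using fibre_points_separate[OF w zero nonint T(2) Y(2)] by blast
  have large: "card (E k) > column_number l \<theta>" if "k \<ge> K" for k
  proof -
    have "(\<lambda>x. corner_pattern J (Y k x)) ` T \<subseteq> E k"
      using E(3)[of k] in_images by blast
    then have "card T \<le> card (E k)"
      using card_inj_on_le[OF K[OF that] _ finite_graph_vert[OF E(1)]] by blast
    then show ?thesis
      using T(3) by simp
  qed
  obtain n' k1 where n': "n' \<in> label_shift l \<theta> J" "\<And>k. n' k \<in> labels_at l J"
      "\<And>k. k \<ge> k1 \<Longrightarrow> n' k = n k"
    by (rule replace_beginning[where n = n and E = E and J = J and K = K, OF n E(1) E(2) large])
       (assumption, rule that)
  obtain N where "odo_add l w (odo_of_int l N) = odo_of_digits l n'"
    using odo_of_digits_tail[of n n' k1] labels_in_supp[OF n] labels_in_supp[OF n'(2)] n'(3) digits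
    by metis
  then show ?thesis
    using n'(1) by (metis image_eqI)
qed

theorem irregular_fibre_iff_sofic:
  assumes z: "z \<in> odometer l" and nonint: "z \<notin> range (odo_of_int l)"
  shows "irregular_fibre l \<theta> z \<longleftrightarrow>
    (\<exists>N. odo_add l z (odo_of_int l N) \<in> odo_of_digits l ` sofic_shift l \<theta>)"
proof
  assume "\<exists>N. odo_add l z (odo_of_int l N) \<in> odo_of_digits l ` sofic_shift l \<theta>"
  then obtain N J n where "n \<in> label_shift l \<theta> J" "odo_add l z (odo_of_int l N) = odo_of_digits l n"
    by (auto simp: sofic_shift_def)
  then show "irregular_fibre l \<theta> z"
    using label_shift_irregular irregular_fibre_shift[OF z] by metis
next
  assume irregular: "irregular_fibre l \<theta> z"
  define J where "J = {i. \<exists>m. \<forall>k. z k $ i = m mod l $ i ^ k}"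
  have "\<exists>M. \<forall>i\<in>J. \<forall>k. z k $ i = M i mod l $ i ^ k"
    by (rule bchoice) (simp add: J_def)
  then obtain M where M: "\<And>i k. i \<in> J \<Longrightarrow> z k $ i = M i mod l $ i ^ k"
    by blast
  have "J \<subset> UNIV"
  proof (rule ccontr)
    assume "\<not> J \<subset> UNIV"
    then have "i \<in> J" for i by blast
    then have "z = odo_of_int l (vec_lambda M)"
      using M by (simp add: odo_of_int_def qmod_def vec_eq_iff fun_eq_iff)
    then show False
      using nonint by blast
  qed
  \<comment> \<open>translating by \<open>N\<close> moves the integral coordinates to \<open>0\<close> and fixes the others\<close>
  define N where "N = (\<chi> i. if i \<in> J then - M i else 0)"
  define w where "w = odo_add l z (odo_of_int l N)"
  have w: "w \<in> odometer l"
    unfolding w_def by (rule odo_add_int_in_odometer[OF z])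
  have "w k $ i = 0" if "i \<in> J" for i k
    using M[OF that, of k] that mod_add_left_eq[of "M i" "l $ i ^ k" "- M i"]
    by (simp add: w_def odo_add_int qmod_def N_def)
  moreover have "w k $ i = z k $ i" if "i \<notin> J" for i k
    using that odometer_in_supp[OF z, of k] by (simp add: w_def odo_add_int qmod_def N_def supp_def)
  then have "\<not> (\<exists>m. \<forall>k. w k $ i = m mod l $ i ^ k)" if "i \<notin> J" for i
    using that by (simp add: J_def)
  moreover have "irregular_fibre l \<theta> w"
    unfolding w_def using irregular irregular_fibre_shift[OF z] by blast
  ultimately obtain N' where "odo_add l w (odo_of_int l N') \<in> odo_of_digits l ` label_shift l \<theta> J"
    using irregular_label_shift[OF w] by metis
  then have "odo_add l z (odo_of_int l (N + N')) \<in> odo_of_digits l ` sofic_shift l \<theta>"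
    using \<open>J \<subset> UNIV\<close> by (auto simp: w_def odo_add_add sofic_shift_def)
  then show "\<exists>N. odo_add l z (odo_of_int l N) \<in> odo_of_digits l ` sofic_shift l \<theta>"
    by blast
qed

end

theorem theorem47:
  fixes l :: "int ^ 'd::finite"
    and \<theta> :: "'a::finite \<Rightarrow> int ^ 'd \<Rightarrow> 'a"
    and z :: "nat \<Rightarrow> int ^ 'd"
  assumes "\<forall>i. l $ i \<ge> 2"
    and "injective_subst l \<theta>"
    and "primitive_subst l \<theta>"
    and "aperiodic_subst l \<theta>"
    and "trivial_height l \<theta>"
    and "z \<in> odometer l - range (odo_of_int l)"
  shows "irregular_fibre l \<theta> z \<longleftrightarrow>
    (\<exists>N. odo_add l z (odo_of_int l N) \<in> odo_of_digits l ` sofic_shift l \<theta>)"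
proof -
  interpret aperiodic_substitution l \<theta>
    using assms by unfold_locales (auto simp: trivial_height_def)
  show ?thesis
    using assms by (intro irregular_fibre_iff_sofic) auto
qed

end
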